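(* Let a discrete group $G$ act on a discrete group $H$ by automorphisms. Then $H\rtimes G$ is RF if and only if $G$ is RF and the elements of $\widehat H$ with finite images whose orbits are finite separate points of $H$.
   Context: A group is RF (residually finite) if its homomorphisms to finite groups separate its points. $\widehat H$ is the set of unitary equivalence classes of irreducible unitary representations of $H$. The action $\alpha$ of $G$ on $H$ induces the action of $G$ on $\widehat H$ given by $(g\cdot\rho)(h)=\rho(\alpha_{g^{-1}}(h))$, and orbits are taken with respect to this action. *)

theory Defs
  imports "HOL-Analysis.Analysis" "HOL-Algebra.Algebra"
    "HOL-Algebra.Algebraic_Closure_Type"
begin

section \<open>Residual finiteness and semidirect products\<close>

text \<open>Every finite group is isomorphic to one whose carrier is a set of natural numbers, so
  letting the finite target range over this one type loses nothing; see
  \<open>separated_by_finite_group\<close> below.\<close>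

definition residually_finite :: "('a, 'm) monoid_scheme \<Rightarrow> bool" where
  "residually_finite G \<longleftrightarrow>
     (\<forall>x\<in>carrier G. \<forall>y\<in>carrier G. x \<noteq> y \<longrightarrow>
        (\<exists>F :: nat monoid. group F \<and> finite (carrier F) \<and> (\<exists>\<phi>\<in>hom G F. \<phi> x \<noteq> \<phi> y)))"

lemma separated_by_finite_group:
  fixes F :: "('b, 'n) monoid_scheme"
  assumes F: "group F" "finite (carrier F)" and \<phi>: "\<phi> \<in> hom G F"
    and xy: "x \<in> carrier G" "y \<in> carrier G" "\<phi> x \<noteq> \<phi> y"
  shows "\<exists>F' :: nat monoid. group F' \<and> finite (carrier F') \<and> (\<exists>\<psi>\<in>hom G F'. \<psi> x \<noteq> \<psi> y)"
proof -
  interpret F: group F by fact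
  obtain f :: "'b \<Rightarrow> nat" where f: "inj_on f (carrier F)"
    using F(2) finite_imp_inj_to_nat_seg by blast
  let ?i = "inv_into (carrier F) f"
  define F' :: "nat monoid" where
    "F' = \<lparr>carrier = f ` carrier F, mult = (\<lambda>a b. f (?i a \<otimes>\<^bsub>F\<^esub> ?i b)), one = f \<one>\<^bsub>F\<^esub>\<rparr>"
  have "group F'"
    by (rule groupI) (auto simp: F'_def f F.m_assoc intro!: bexI[of _ "inv\<^bsub>F\<^esub> _"])
  moreover have "finite (carrier F')"
    using F(2) by (simp add: F'_def)
  moreover have "f \<circ> \<phi> \<in> hom G F'"
    using \<phi> f by (auto simp: hom_def F'_def Pi_iff)
  moreover have "(f \<circ> \<phi>) x \<noteq> (f \<circ> \<phi>) y"
    using \<phi> f xy by (auto simp: hom_def Pi_iff inj_on_def)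
  ultimately show ?thesis by blast
qed

definition semidirect_product ::
  "('h, 'm) monoid_scheme \<Rightarrow> ('g, 'n) monoid_scheme \<Rightarrow> ('g \<Rightarrow> 'h \<Rightarrow> 'h) \<Rightarrow> ('h \<times> 'g) monoid" where
  "semidirect_product H G \<alpha> =
     \<lparr>carrier = carrier H \<times> carrier G,
      mult = (\<lambda>(h, g) (h', g'). (h \<otimes>\<^bsub>H\<^esub> \<alpha> g h', g \<otimes>\<^bsub>G\<^esub> g')),
      one = (\<one>\<^bsub>H\<^esub>, \<one>\<^bsub>G\<^esub>)\<rparr>"

lemma group_semidirect_product:
  assumes "group G" "group H" "group_hom G (AutoGroup H) \<alpha>"
  shows "group (semidirect_product H G \<alpha>)"
proof -
  interpret G: group G by fact
  interpret H: group H by fact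
  interpret A: group_hom G "AutoGroup H" \<alpha> by fact
  have au: "\<alpha> g \<in> hom H H \<inter> Bij (carrier H)" if "g \<in> carrier G" for g
    using A.hom_closed[OF that] by (simp add: AutoGroup_def auto_def)
  then have cl: "\<alpha> g h \<in> carrier H" if "g \<in> carrier G" "h \<in> carrier H" for g h
    using that by (auto simp: hom_def)
  have ml: "\<alpha> g (h \<otimes>\<^bsub>H\<^esub> h') = \<alpha> g h \<otimes>\<^bsub>H\<^esub> \<alpha> g h'"
    if "g \<in> carrier G" "h \<in> carrier H" "h' \<in> carrier H" for g h h'
    using au[OF that(1)] that by (auto simp: hom_def)
  have co: "\<alpha> (g \<otimes>\<^bsub>G\<^esub> g') h = \<alpha> g (\<alpha> g' h)"
    if "g \<in> carrier G" "g' \<in> carrier G" "h \<in> carrier H" for g g' h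
    using A.hom_mult[OF that(1,2)] au[OF that(1)] au[OF that(2)] that
    by (simp add: AutoGroup_def BijGroup_def compose_def)
  have id: "\<alpha> \<one>\<^bsub>G\<^esub> h = h" if "h \<in> carrier H" for h
  proof -
    have "\<alpha> \<one>\<^bsub>G\<^esub> = \<one>\<^bsub>AutoGroup H\<^esub>"
      using G.group_axioms H.AutoGroup A.homh hom_one by blast
    then show ?thesis
      using that by (simp add: AutoGroup_def BijGroup_def)
  qed
  show ?thesis
  proof (rule groupI)
    fix x assume "x \<in> carrier (semidirect_product H G \<alpha>)"
    then obtain h g where x: "x = (h, g)" "h \<in> carrier H" "g \<in> carrier G"
      by (auto simp: semidirect_product_def)
    have "\<alpha> (inv\<^bsub>G\<^esub> g) (inv\<^bsub>H\<^esub> h) \<otimes>\<^bsub>H\<^esub> \<alpha> (inv\<^bsub>G\<^esub> g) h = \<alpha> (inv\<^bsub>G\<^esub> g) \<one>\<^bsub>H\<^esub>"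
      using x ml[of "inv\<^bsub>G\<^esub> g" "inv\<^bsub>H\<^esub> h" h] by (simp del: A.hom_inv)
    also have "\<dots> = \<one>\<^bsub>H\<^esub>"
      using au[of "inv\<^bsub>G\<^esub> g"] x hom_one[OF _ H.group_axioms H.group_axioms] by auto
    finally show "\<exists>y\<in>carrier (semidirect_product H G \<alpha>).
        y \<otimes>\<^bsub>semidirect_product H G \<alpha>\<^esub> x = \<one>\<^bsub>semidirect_product H G \<alpha>\<^esub>"
      using x by (intro bexI[of _ "(\<alpha> (inv\<^bsub>G\<^esub> g) (inv\<^bsub>H\<^esub> h), inv\<^bsub>G\<^esub> g)"])
        (auto simp: semidirect_product_def cl simp del: A.hom_inv)
  qed (auto simp: semidirect_product_def cl ml co id H.m_assoc G.m_assoc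
      simp del: A.hom_one A.hom_mult)
qed


section \<open>Complex Hilbert spaces with explicit carrier\<close>

text \<open>Hilbert spaces are carrier-based because the unitary dual quantifies over all of them.
  A vector space over \<open>\<complex>\<close> is a module over the ring of complex numbers; the ring
  multiplication and unit inherited from the record \<open>module\<close> are ignored.\<close>

record 'v inner_space = "(complex, 'v) module" +
  cinner :: "'v \<Rightarrow> 'v \<Rightarrow> complex" ("\<langle>_,/ _\<rangle>\<index>")

abbreviation complex_ring :: "complex ring" where
  "complex_ring \<equiv> ring_of_type_algebra"

definition vnorm :: "('v, 'm) inner_space_scheme \<Rightarrow> 'v \<Rightarrow> real" where
  "vnorm V x = sqrt (Re \<langle>x, x\<rangle>\<^bsub>V\<^esub>)"

text \<open>The locale \<open>Metric_space\<close> requires symmetry and nonnegativity also outside the carrier,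
  hence the guard.\<close>

definition vdist :: "('v, 'm) inner_space_scheme \<Rightarrow> 'v \<Rightarrow> 'v \<Rightarrow> real" where
  "vdist V x y = (if x \<in> carrier V \<and> y \<in> carrier V then vnorm V (x \<ominus>\<^bsub>V\<^esub> y) else 0)"

locale complex_inner_space = Module.module complex_ring V
  for V :: "('v, 'm) inner_space_scheme" (structure) +
  assumes cinner_commute:
      "\<lbrakk>x \<in> carrier V; y \<in> carrier V\<rbrakk> \<Longrightarrow> \<langle>y, x\<rangle> = cnj \<langle>x, y\<rangle>"
    and cinner_add_left:
      "\<lbrakk>x \<in> carrier V; y \<in> carrier V; z \<in> carrier V\<rbrakk> \<Longrightarrow> \<langle>x \<oplus>\<^bsub>V\<^esub> y, z\<rangle> = \<langle>x, z\<rangle> + \<langle>y, z\<rangle>"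
    and cinner_smult_left:
      "\<lbrakk>x \<in> carrier V; y \<in> carrier V\<rbrakk> \<Longrightarrow> \<langle>c \<odot> x, y\<rangle> = c * \<langle>x, y\<rangle>"
    and cinner_ge_zero: "x \<in> carrier V \<Longrightarrow> Re \<langle>x, x\<rangle> \<ge> 0"
    and cinner_eq_zero: "\<lbrakk>x \<in> carrier V; \<langle>x, x\<rangle> = 0\<rbrakk> \<Longrightarrow> x = \<zero>\<^bsub>V\<^esub>"
begin

lemma carrier_complex_ring [simp]: "c \<in> carrier complex_ring"
  by (simp add: ring_of_type_algebra_def)

lemma smult_in [simp]: "x \<in> carrier V \<Longrightarrow> c \<odot> x \<in> carrier V"
  by (rule smult_closed) auto

lemma cinner_zero_left [simp]: "y \<in> carrier V \<Longrightarrow> \<langle>\<zero>\<^bsub>V\<^esub>, y\<rangle> = 0"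
  using cinner_add_left[of "\<zero>\<^bsub>V\<^esub>" "\<zero>\<^bsub>V\<^esub>" y] by simp

lemma cinner_minus_left: "\<lbrakk>x \<in> carrier V; y \<in> carrier V\<rbrakk> \<Longrightarrow> \<langle>\<ominus>\<^bsub>V\<^esub> x, y\<rangle> = - \<langle>x, y\<rangle>"
  using cinner_add_left[of x "\<ominus>\<^bsub>V\<^esub> x" y] by (simp add: M.r_neg add_eq_0_iff)

lemma cinner_diff_left:
  "\<lbrakk>x \<in> carrier V; y \<in> carrier V; z \<in> carrier V\<rbrakk> \<Longrightarrow> \<langle>x \<ominus>\<^bsub>V\<^esub> y, z\<rangle> = \<langle>x, z\<rangle> - \<langle>y, z\<rangle>"
  by (simp add: a_minus_def cinner_add_left cinner_minus_left)

lemma cinner_add_right: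
  "\<lbrakk>x \<in> carrier V; y \<in> carrier V; z \<in> carrier V\<rbrakk> \<Longrightarrow> \<langle>z, x \<oplus>\<^bsub>V\<^esub> y\<rangle> = \<langle>z, x\<rangle> + \<langle>z, y\<rangle>"
  by (metis cinner_add_left cinner_commute complex_cnj_add M.a_closed)

lemma cinner_diff_right:
  "\<lbrakk>x \<in> carrier V; y \<in> carrier V; z \<in> carrier V\<rbrakk> \<Longrightarrow> \<langle>z, x \<ominus>\<^bsub>V\<^esub> y\<rangle> = \<langle>z, x\<rangle> - \<langle>z, y\<rangle>"
  by (metis cinner_diff_left cinner_commute complex_cnj_diff M.minus_closed)

lemma cinner_smult_right:
  "\<lbrakk>x \<in> carrier V; y \<in> carrier V\<rbrakk> \<Longrightarrow> \<langle>y, c \<odot> x\<rangle> = cnj c * \<langle>y, x\<rangle>"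
  by (metis cinner_smult_left cinner_commute complex_cnj_mult smult_in)

lemma cinner_self: "x \<in> carrier V \<Longrightarrow> \<langle>x, x\<rangle> = complex_of_real ((vnorm V x)\<^sup>2)"
  using cinner_commute[of x x] cinner_ge_zero[of x]
  by (auto simp: vnorm_def complex_eq_iff)

lemma vnorm_nonneg [simp]: "x \<in> carrier V \<Longrightarrow> vnorm V x \<ge> 0"
  by (simp add: vnorm_def cinner_ge_zero)

lemma vnorm_eq_0_iff: "x \<in> carrier V \<Longrightarrow> vnorm V x = 0 \<longleftrightarrow> x = \<zero>\<^bsub>V\<^esub>"
  using cinner_self[of x] cinner_eq_zero[of x] by (auto simp: vnorm_def)

lemma Cauchy_Schwarz:
  assumes x: "x \<in> carrier V" and y: "y \<in> carrier V"
  shows "cmod \<langle>x, y\<rangle> \<le> vnorm V x * vnorm V y"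
proof (cases "y = \<zero>\<^bsub>V\<^esub>")
  case True
  then show ?thesis using x cinner_commute[of "\<zero>\<^bsub>V\<^esub>" x] vnorm_eq_0_iff[OF y] by simp
next
  case False
  define n where "n = (vnorm V y)\<^sup>2"
  have n: "n > 0" using False vnorm_eq_0_iff[OF y] by (simp add: n_def)
  define c where "c = \<langle>x, y\<rangle> / n"
  have yy: "\<langle>y, y\<rangle> = n" using cinner_self[OF y] by (simp add: n_def)
  have "\<langle>x \<ominus>\<^bsub>V\<^esub> c \<odot> y, x \<ominus>\<^bsub>V\<^esub> c \<odot> y\<rangle> = \<langle>x, x\<rangle> - cnj c * \<langle>x, y\<rangle> - c * cnj \<langle>x, y\<rangle> + c * cnj c * n"
    using x y cinner_commute[OF x y]
    by (simp add: cinner_diff_left cinner_diff_right cinner_smult_left cinner_smult_right yy algebra_simps)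
  also have "\<dots> = \<langle>x, x\<rangle> - \<langle>x, y\<rangle> * cnj \<langle>x, y\<rangle> / n"
    using n by (simp add: c_def field_simps)
  also have "\<dots> = complex_of_real ((vnorm V x)\<^sup>2 - (cmod \<langle>x, y\<rangle>)\<^sup>2 / n)"
    by (simp add: cinner_self[OF x] complex_norm_square[symmetric] flip: of_real_power)
  finally have "(vnorm V x)\<^sup>2 - (cmod \<langle>x, y\<rangle>)\<^sup>2 / n \<ge> 0"
    using cinner_ge_zero[of "x \<ominus>\<^bsub>V\<^esub> c \<odot> y"] x y by (simp add: M.minus_closed)
  then have "(cmod \<langle>x, y\<rangle>)\<^sup>2 / n \<le> (vnorm V x)\<^sup>2"
    by linarith
  then have "(cmod \<langle>x, y\<rangle>)\<^sup>2 \<le> (vnorm V x)\<^sup>2 * n"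
    by (simp only: pos_divide_le_eq[OF n])
  then have "(cmod \<langle>x, y\<rangle>)\<^sup>2 \<le> (vnorm V x * vnorm V y)\<^sup>2"
    by (simp only: n_def power_mult_distrib)
  then show ?thesis
    by (rule power2_le_imp_le) (intro mult_nonneg_nonneg vnorm_nonneg x y)
qed

lemma vnorm_triangle:
  assumes x: "x \<in> carrier V" and y: "y \<in> carrier V"
  shows "vnorm V (x \<oplus>\<^bsub>V\<^esub> y) \<le> vnorm V x + vnorm V y"
proof -
  have "\<langle>x \<oplus>\<^bsub>V\<^esub> y, x \<oplus>\<^bsub>V\<^esub> y\<rangle> = \<langle>x, x\<rangle> + \<langle>y, y\<rangle> + (\<langle>x, y\<rangle> + cnj \<langle>x, y\<rangle>)"
    using x y cinner_commute[OF x y] by (simp add: cinner_add_left cinner_add_right)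
  then have "complex_of_real ((vnorm V (x \<oplus>\<^bsub>V\<^esub> y))\<^sup>2)
      = complex_of_real ((vnorm V x)\<^sup>2 + (vnorm V y)\<^sup>2 + 2 * Re \<langle>x, y\<rangle>)"
    using x y by (simp only: cinner_self M.a_closed complex_add_cnj of_real_add)
  then have "(vnorm V (x \<oplus>\<^bsub>V\<^esub> y))\<^sup>2 = (vnorm V x)\<^sup>2 + (vnorm V y)\<^sup>2 + 2 * Re \<langle>x, y\<rangle>"
    by (simp only: of_real_eq_iff)
  also have "\<dots> \<le> (vnorm V x + vnorm V y)\<^sup>2"
    using Cauchy_Schwarz[OF x y] complex_Re_le_cmod[of "\<langle>x, y\<rangle>"]
    by (simp add: power2_sum)
  finally show ?thesis
    by (rule power2_le_imp_le) (intro add_nonneg_nonneg vnorm_nonneg x y)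
qed

lemma vdist_commute: "vdist V x y = vdist V y x"
proof -
  have "\<langle>x \<ominus>\<^bsub>V\<^esub> y, x \<ominus>\<^bsub>V\<^esub> y\<rangle> = \<langle>y \<ominus>\<^bsub>V\<^esub> x, y \<ominus>\<^bsub>V\<^esub> x\<rangle>"
    if x: "x \<in> carrier V" and y: "y \<in> carrier V"
    unfolding cinner_diff_left[OF x y M.minus_closed[OF x y]] cinner_diff_left[OF y x M.minus_closed[OF y x]]
      cinner_diff_right[OF x y x] cinner_diff_right[OF x y y] cinner_diff_right[OF y x x] cinner_diff_right[OF y x y]
    by simp
  then show ?thesis unfolding vdist_def vnorm_def by presburger
qed

lemma vdist_triangle:
  assumes "x \<in> carrier V" "y \<in> carrier V" "z \<in> carrier V"
  shows "vdist V x z \<le> vdist V x y + vdist V y z"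
proof -
  have "\<ominus>\<^bsub>V\<^esub> y \<oplus>\<^bsub>V\<^esub> (y \<oplus>\<^bsub>V\<^esub> \<ominus>\<^bsub>V\<^esub> z) = \<ominus>\<^bsub>V\<^esub> z"
    using assms by (intro M.r_neg1) auto
  then have "x \<ominus>\<^bsub>V\<^esub> z = (x \<ominus>\<^bsub>V\<^esub> y) \<oplus>\<^bsub>V\<^esub> (y \<ominus>\<^bsub>V\<^esub> z)"
    using assms unfolding a_minus_def by (subst M.a_assoc) auto
  then show ?thesis
    using vnorm_triangle[of "x \<ominus>\<^bsub>V\<^esub> y" "y \<ominus>\<^bsub>V\<^esub> z"] assms by (simp add: vdist_def)
qed

lemma Metric_space_vdist: "Metric_space (carrier V) (vdist V)"
proof (rule Metric_space.intro)
  show "0 \<le> vdist V x y" for x y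
    by (simp add: vdist_def)
  show "vdist V x y = vdist V y x" for x y
    by (rule vdist_commute)
  show "vdist V x y = 0 \<longleftrightarrow> x = y" if "x \<in> carrier V" "y \<in> carrier V" for x y
    using that M.minus_equality[of x "\<ominus>\<^bsub>V\<^esub> y"]
    by (auto simp: vdist_def vnorm_eq_0_iff a_minus_def M.r_neg)
  show "vdist V x z \<le> vdist V x y + vdist V y z"
    if "x \<in> carrier V" "y \<in> carrier V" "z \<in> carrier V" for x y z
    using that by (rule vdist_triangle)
qed

sublocale metric: Metric_space "carrier V" "vdist V"
  by (rule Metric_space_vdist)

end

locale complex_hilbert_space = complex_inner_space +
  assumes complete: "metric.mcomplete"

definition unitary_map ::
  "('v, 'm) inner_space_scheme \<Rightarrow> ('w, 'n) inner_space_scheme \<Rightarrow> ('v \<Rightarrow> 'w) \<Rightarrow> bool" where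
  "unitary_map V W U \<longleftrightarrow>
     bij_betw U (carrier V) (carrier W) \<and>
     (\<forall>x\<in>carrier V. \<forall>y\<in>carrier V. U (x \<oplus>\<^bsub>V\<^esub> y) = U x \<oplus>\<^bsub>W\<^esub> U y) \<and>
     (\<forall>c. \<forall>x\<in>carrier V. U (c \<odot>\<^bsub>V\<^esub> x) = c \<odot>\<^bsub>W\<^esub> U x) \<and>
     (\<forall>x\<in>carrier V. \<forall>y\<in>carrier V. \<langle>U x, U y\<rangle>\<^bsub>W\<^esub> = \<langle>x, y\<rangle>\<^bsub>V\<^esub>)"

definition UnitaryGroup :: "('v, 'm) inner_space_scheme \<Rightarrow> ('v \<Rightarrow> 'v) monoid" where
  "UnitaryGroup V = BijGroup (carrier V) \<lparr>carrier := {U \<in> Bij (carrier V). unitary_map V V U}\<rparr>"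


section \<open>The unitary dual\<close>

definition unitary_rep ::
  "('h, 'n) monoid_scheme \<Rightarrow> 'v inner_space \<Rightarrow> ('h \<Rightarrow> 'v \<Rightarrow> 'v) \<Rightarrow> bool" where
  "unitary_rep H V \<rho> \<longleftrightarrow> complex_hilbert_space V \<and> \<rho> \<in> hom H (UnitaryGroup V)"

definition irreducible_rep ::
  "('h, 'n) monoid_scheme \<Rightarrow> 'v inner_space \<Rightarrow> ('h \<Rightarrow> 'v \<Rightarrow> 'v) \<Rightarrow> bool" where
  "irreducible_rep H V \<rho> \<longleftrightarrow>
     carrier V \<noteq> {\<zero>\<^bsub>V\<^esub>} \<and>
     (\<forall>W. submodule W complex_ring V \<and>
          closedin (Metric_space.mtopology (carrier V) (vdist V)) W \<and>
          (\<forall>h\<in>carrier H. \<rho> h ` W \<subseteq> W) \<longrightarrow>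
        W = {\<zero>\<^bsub>V\<^esub>} \<or> W = carrier V)"

text \<open>A Hilbert space carrying an irreducible representation of \<open>H\<close> is the closed linear span of
  one orbit, so it has an orthonormal basis indexed by a subset of \<open>H \<times> \<nat>\<close> and is
  unitarily isomorphic to a subspace of \<open>\<ell>\<^sup>2(H \<times> \<nat>)\<close>. Hence every unitary equivalence class is
  represented on a Hilbert space whose carrier lies in the following type.\<close>

type_synonym 'h rep_space = "'h \<times> nat \<Rightarrow> complex"

type_synonym 'h rep = "'h rep_space inner_space \<times> ('h \<Rightarrow> 'h rep_space \<Rightarrow> 'h rep_space)"

definition irreps :: "('h, 'n) monoid_scheme \<Rightarrow> 'h rep set" where
  "irreps H = {(V, \<rho>). unitary_rep H V \<rho> \<and> irreducible_rep H V \<rho>}"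

definition unitary_equivalence :: "('h, 'n) monoid_scheme \<Rightarrow> 'h rep rel" where
  "unitary_equivalence H =
     {((V, \<rho>), (W, \<sigma>)). (V, \<rho>) \<in> irreps H \<and> (W, \<sigma>) \<in> irreps H \<and>
        (\<exists>U. unitary_map V W U \<and> (\<forall>h\<in>carrier H. \<forall>v\<in>carrier V. U (\<rho> h v) = \<sigma> h (U v)))}"

definition unitary_dual :: "('h, 'n) monoid_scheme \<Rightarrow> 'h rep set set" where
  "unitary_dual H = irreps H // unitary_equivalence H"

definition rep_act ::
  "('g, 'm) monoid_scheme \<Rightarrow> ('g \<Rightarrow> 'h \<Rightarrow> 'h) \<Rightarrow> 'g \<Rightarrow> 'h rep \<Rightarrow> 'h rep" where
  "rep_act G \<alpha> g = (\<lambda>(V, \<rho>). (V, \<lambda>h. \<rho> (\<alpha> (inv\<^bsub>G\<^esub> g) h)))"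

definition dual_act ::
  "('g, 'm) monoid_scheme \<Rightarrow> ('h, 'n) monoid_scheme \<Rightarrow> ('g \<Rightarrow> 'h \<Rightarrow> 'h) \<Rightarrow>
   'g \<Rightarrow> 'h rep set \<Rightarrow> 'h rep set" where
  "dual_act G H \<alpha> g c = (\<Union>r\<in>c. unitary_equivalence H `` {rep_act G \<alpha> g r})"

text \<open>Having finite image, and separating two given points, are invariant under unitary
  equivalence (lemmas \<open>finite_image_cong\<close> and \<open>separates_cong\<close>), so on a class it does not
  matter which representative is inspected.\<close>

definition has_finite_image :: "('h, 'n) monoid_scheme \<Rightarrow> 'h rep set \<Rightarrow> bool" where
  "has_finite_image H c \<longleftrightarrow> (\<exists>(V, \<rho>)\<in>c. finite (\<rho> ` carrier H))"

definition separates_points :: "'h rep set set \<Rightarrow> ('h, 'n) monoid_scheme \<Rightarrow> bool" where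
  "separates_points C H \<longleftrightarrow>
     (\<forall>x\<in>carrier H. \<forall>y\<in>carrier H. x \<noteq> y \<longrightarrow> (\<exists>c\<in>C. \<exists>(V, \<rho>)\<in>c. \<rho> x \<noteq> \<rho> y))"

lemma unitary_map_inv:
  assumes U: "unitary_map V W U" and V: "complex_hilbert_space V"
  shows "unitary_map W V (inv_into (carrier V) U)"
proof -
  interpret V: complex_hilbert_space V by fact
  have b: "bij_betw U (carrier V) (carrier W)" using U by (simp add: unitary_map_def)
  have i: "\<exists>v\<in>carrier V. w = U v" if "w \<in> carrier W" for w
    using b that by (auto simp: bij_betw_def)
  have l: "inv_into (carrier V) U (U v) = v" if "v \<in> carrier V" for v
    using b that by (auto simp: bij_betw_def)
  show ?thesis unfolding unitary_map_def
  proof (intro conjI ballI allI)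
    show "bij_betw (inv_into (carrier V) U) (carrier W) (carrier V)"
      using b by (rule bij_betw_inv_into)
  next
    fix x y assume "x \<in> carrier W" "y \<in> carrier W"
    then obtain v w where vw: "v \<in> carrier V" "w \<in> carrier V" "x = U v" "y = U w"
      using i by blast
    then have "x \<oplus>\<^bsub>W\<^esub> y = U (v \<oplus>\<^bsub>V\<^esub> w)" "\<langle>x, y\<rangle>\<^bsub>W\<^esub> = \<langle>v, w\<rangle>\<^bsub>V\<^esub>"
      using U by (simp_all add: unitary_map_def)
    then show "inv_into (carrier V) U (x \<oplus>\<^bsub>W\<^esub> y) = inv_into (carrier V) U x \<oplus>\<^bsub>V\<^esub> inv_into (carrier V) U y"
      and "\<langle>inv_into (carrier V) U x, inv_into (carrier V) U y\<rangle>\<^bsub>V\<^esub> = \<langle>x, y\<rangle>\<^bsub>W\<^esub>"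
      using vw by (simp_all add: l)
  next
    fix c x assume "x \<in> carrier W"
    then obtain v where v: "v \<in> carrier V" "x = U v" using i by blast
    then have "c \<odot>\<^bsub>W\<^esub> x = U (c \<odot>\<^bsub>V\<^esub> v)" using U by (simp add: unitary_map_def)
    then show "inv_into (carrier V) U (c \<odot>\<^bsub>W\<^esub> x) = c \<odot>\<^bsub>V\<^esub> inv_into (carrier V) U x"
      using v by (simp add: l)
  qed
qed

lemma unitary_map_comp:
  "\<lbrakk>unitary_map V W U; unitary_map W Y T\<rbrakk> \<Longrightarrow> unitary_map V Y (T \<circ> U)"
  unfolding unitary_map_def
  by (auto intro: bij_betw_trans simp: bij_betw_apply)

lemma unitary_rep_closed:
  "\<lbrakk>unitary_rep H V \<rho>; h \<in> carrier H\<rbrakk> \<Longrightarrow> \<rho> h \<in> Bij (carrier V)"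
  by (auto simp: unitary_rep_def hom_def UnitaryGroup_def)

lemma equiv_unitary_equivalence: "equiv (irreps H) (unitary_equivalence H)"
proof (rule equivI)
  show "unitary_equivalence H \<subseteq> irreps H \<times> irreps H"
    by (auto simp: unitary_equivalence_def)
  show "refl_on (irreps H) (unitary_equivalence H)"
  proof (rule refl_onI)
    fix r assume "r \<in> irreps H"
    then show "(r, r) \<in> unitary_equivalence H"
      by (auto simp: unitary_equivalence_def unitary_map_def split: prod.split
          intro!: exI[of _ "\<lambda>x. x"] bij_betw_byWitness[of _ "\<lambda>x. x"])
  qed
  show "sym (unitary_equivalence H)"
  proof (rule symI)
    fix r s assume rs: "(r, s) \<in> unitary_equivalence H"
    obtain V \<rho> W \<sigma> where eq: "r = (V, \<rho>)" "s = (W, \<sigma>)" by (cases r, cases s)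
    from rs obtain U where irr: "(V, \<rho>) \<in> irreps H" "(W, \<sigma>) \<in> irreps H"
      and U: "unitary_map V W U" and tw: "\<And>h v. h \<in> carrier H \<Longrightarrow> v \<in> carrier V \<Longrightarrow> U (\<rho> h v) = \<sigma> h (U v)"
      by (auto simp: unitary_equivalence_def eq)
    let ?T = "inv_into (carrier V) U"
    have rep: "unitary_rep H V \<rho>" using irr by (simp add: irreps_def)
    have b: "bij_betw U (carrier V) (carrier W)" using U by (simp add: unitary_map_def)
    have "?T (\<sigma> h w) = \<rho> h (?T w)" if h: "h \<in> carrier H" and w: "w \<in> carrier W" for h w
    proof -
      have "w \<in> U ` carrier V" using b w by (simp add: bij_betw_def)
      then obtain v where v: "v \<in> carrier V" "w = U v" by blast
      have "\<rho> h v \<in> carrier V"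
        by (rule funcset_mem[OF Bij_imp_funcset[OF unitary_rep_closed[OF rep h]] v(1)])
      moreover have "inj_on U (carrier V)" using b by (simp add: bij_betw_def)
      ultimately show ?thesis using v tw[OF h v(1), symmetric] by (simp add: inv_into_f_f)
    qed
    moreover have "unitary_map W V ?T"
      using unitary_map_inv[OF U] rep by (simp add: unitary_rep_def)
    ultimately show "(s, r) \<in> unitary_equivalence H"
      using irr by (auto simp: unitary_equivalence_def eq)
  qed
  show "trans (unitary_equivalence H)"
  proof (rule transI)
    fix r s t assume rs: "(r, s) \<in> unitary_equivalence H" "(s, t) \<in> unitary_equivalence H"
    obtain V \<rho> W \<sigma> Y \<tau> where eq: "r = (V, \<rho>)" "s = (W, \<sigma>)" "t = (Y, \<tau>)" by (cases r, cases s, cases t)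
    from rs obtain U T where irr: "(V, \<rho>) \<in> irreps H" "(Y, \<tau>) \<in> irreps H"
      and U: "unitary_map V W U" "\<And>h v. h \<in> carrier H \<Longrightarrow> v \<in> carrier V \<Longrightarrow> U (\<rho> h v) = \<sigma> h (U v)"
      and T: "unitary_map W Y T" "\<And>h v. h \<in> carrier H \<Longrightarrow> v \<in> carrier W \<Longrightarrow> T (\<sigma> h v) = \<tau> h (T v)"
      unfolding unitary_equivalence_def eq by blast
    have "U v \<in> carrier W" if "v \<in> carrier V" for v
      using U(1) that by (auto simp: unitary_map_def bij_betw_apply)
    then have "\<forall>h\<in>carrier H. \<forall>v\<in>carrier V. (T \<circ> U) (\<rho> h v) = \<tau> h ((T \<circ> U) v)"
      by (simp add: U(2) T(2))
    with unitary_map_comp[OF U(1) T(1)] irr show "(r, t) \<in> unitary_equivalence H"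
      unfolding unitary_equivalence_def eq by blast
  qed
qed

lemma separates_cong:
  assumes eq: "((V, \<rho>), (W, \<sigma>)) \<in> unitary_equivalence H"
    and xy: "x \<in> carrier H" "y \<in> carrier H"
  shows "\<rho> x = \<rho> y \<longleftrightarrow> \<sigma> x = \<sigma> y"
proof -
  have *: "\<sigma> x = \<sigma> y"
    if eq: "((V, \<rho>), (W, \<sigma>)) \<in> unitary_equivalence H" and "\<rho> x = \<rho> y" for V \<rho> W \<sigma>
  proof -
    from eq obtain U where irr: "(W, \<sigma>) \<in> irreps H" and U: "unitary_map V W U"
      and tw: "\<And>h v. h \<in> carrier H \<Longrightarrow> v \<in> carrier V \<Longrightarrow> U (\<rho> h v) = \<sigma> h (U v)"
      by (auto simp: unitary_equivalence_def)
    have "\<sigma> x w = \<sigma> y w" if "w \<in> carrier W" for w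
    proof -
      have "w \<in> U ` carrier V"
        using U \<open>w \<in> carrier W\<close> by (simp add: unitary_map_def bij_betw_def)
      then obtain v where "v \<in> carrier V" "w = U v" by blast
      then show ?thesis using tw[OF xy(1)] tw[OF xy(2)] \<open>\<rho> x = \<rho> y\<close> by metis
    qed
    moreover have "\<sigma> x \<in> extensional (carrier W)" "\<sigma> y \<in> extensional (carrier W)"
      using irr xy unitary_rep_closed[of H W \<sigma>] Bij_imp_extensional by (auto simp: irreps_def)
    ultimately show ?thesis by (auto intro: extensionalityI)
  qed
  have "((W, \<sigma>), (V, \<rho>)) \<in> unitary_equivalence H"
    using eq equiv_unitary_equivalence by (meson equivE symD)
  then show ?thesis using *[OF eq] *[of W \<sigma> V \<rho>] by blast
qed

lemma finite_image_cong:
  assumes eq: "((V, \<rho>), (W, \<sigma>)) \<in> unitary_equivalence H"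
  shows "finite (\<rho> ` carrier H) \<longleftrightarrow> finite (\<sigma> ` carrier H)"
proof -
  have *: "finite (\<sigma> ` carrier H)"
    if eq: "((V, \<rho>), (W, \<sigma>)) \<in> unitary_equivalence H" and fin: "finite (\<rho> ` carrier H)" for V \<rho> W \<sigma>
  proof -
    have "\<sigma> ` carrier H = (\<lambda>u. \<sigma> (inv_into (carrier H) \<rho> u)) ` \<rho> ` carrier H"
    proof -
      have "\<sigma> (inv_into (carrier H) \<rho> (\<rho> h)) = \<sigma> h" if "h \<in> carrier H" for h
        using separates_cong[OF eq, of "inv_into (carrier H) \<rho> (\<rho> h)" h] that
        by (simp add: f_inv_into_f inv_into_into)
      then show ?thesis by (simp add: image_image)
    qed
    then show ?thesis using fin by simp
  qed
  have "((W, \<sigma>), (V, \<rho>)) \<in> unitary_equivalence H"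
    using eq equiv_unitary_equivalence by (meson equivE symD)
  then show ?thesis using *[OF eq] *[of W \<sigma> V \<rho>] by blast
qed

end

theory Submission
  imports Defs
begin

text \<open>Write \<open>K\<close> for the semidirect product of \<open>H\<close> and \<open>G\<close>, and call \<open>(h, g) \<mapsto> (u \<mapsto> h \<alpha>\<^sub>g(u))\<close> its affine
  action on \<open>H\<close>.

  Suppose that \<open>K\<close> is residually finite. Then so is its subgroup \<open>G\<close>. Given \<open>x \<noteq> y\<close> in \<open>H\<close>, some
  homomorphism \<open>\<phi>\<close> from \<open>K\<close> to a finite group \<open>F\<close> separates them. The left regular representation
  of \<open>F\<close> separates \<open>\<phi> x\<close> and \<open>\<phi> y\<close>, hence so does one on a smallest subspace that is invariant under
  \<open>\<phi>(H)\<close> and on which they still act differently, and this one is irreducible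
  (\<open>minimal_separating_subspace\<close>, \<open>exists_separating_irreducible\<close>). Pulled back to \<open>H\<close> it has finite
  image. Its orbit is finite because the action of \<open>g\<close> on \<open>H\<close> is conjugation in \<open>K\<close>, so the translate
  by \<open>g\<close> depends only on the image of \<open>g\<close> under \<open>\<phi>\<close>
  (\<open>separates_if_semidirect_product_residually_finite\<close>).

  Conversely, let \<open>\<rho>\<close> be a representation of \<open>H\<close> with finite image and finite orbit and
  \<open>\<rho> x \<noteq> \<rho> y\<close>. Equivalent representations have the same kernel, so the translates of \<open>\<rho>\<close> have only
  finitely many kernels, each of finite index. Their intersection \<open>N\<close> is normal, invariant under
  \<open>G\<close> and of finite index (\<open>finite_quotient_orbit_relation\<close>). The affine action of \<open>K\<close> permutes the
  cosets of \<open>N\<close>, and the resulting homomorphism to a finite permutation group separates \<open>(x, g)\<close>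
  from \<open>(y, g)\<close> (\<open>separated_by_invariant_relation\<close>). Elements with different components in \<open>G\<close> are
  separated because \<open>G\<close> is residually finite.\<close>

section \<open>Finite-dimensional spaces of functions\<close>

definition supported :: "'i set \<Rightarrow> ('i \<Rightarrow> complex) set" where
  "supported S = {f. \<forall>i. i \<notin> S \<longrightarrow> f i = 0}"

definition function_space ::
  "'i set \<Rightarrow> ('i \<Rightarrow> complex) set \<Rightarrow> ('i \<Rightarrow> complex) inner_space" where
  "function_space S W =
     \<lparr>carrier = W, monoid.mult = (\<lambda>f g i. f i * g i), one = (\<lambda>i. 1),
      ring.zero = (\<lambda>i. 0), add = (\<lambda>f g i. f i + g i), smult = (\<lambda>c f i. c * f i),
      cinner = (\<lambda>f g. \<Sum>i\<in>S. f i * cnj (g i))\<rparr>"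

locale finite_support =
  fixes S :: "'i set"
  assumes finite_S: "finite S"
begin

definition ip :: "('i \<Rightarrow> complex) \<Rightarrow> ('i \<Rightarrow> complex) \<Rightarrow> complex" where
  "ip f g = (\<Sum>i\<in>S. f i * cnj (g i))"

definition lin_subspace :: "('i \<Rightarrow> complex) set \<Rightarrow> bool" where
  "lin_subspace W \<longleftrightarrow> W \<subseteq> supported S \<and> (\<lambda>i. 0) \<in> W \<and>
     (\<forall>f\<in>W. \<forall>g\<in>W. (\<lambda>i. f i + g i) \<in> W) \<and> (\<forall>c. \<forall>f\<in>W. (\<lambda>i. c * f i) \<in> W)"

definition orthonormal :: "('i \<Rightarrow> complex) set \<Rightarrow> bool" where
  "orthonormal B \<longleftrightarrow> (\<forall>e\<in>B. \<forall>d\<in>B. ip e d = (if e = d then 1 else 0))"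

text \<open>For a finite orthonormal set \<open>B\<close> this is the orthogonal projection onto its span.\<close>

definition proj :: "('i \<Rightarrow> complex) set \<Rightarrow> ('i \<Rightarrow> complex) \<Rightarrow> 'i \<Rightarrow> complex" where
  "proj B f = (\<lambda>i. \<Sum>e\<in>B. ip f e * e i)"

text \<open>For a subspace this is its dimension. Counting orthonormal vectors, instead of a basis, bounds
  it by Bessel's inequality and makes it superadditive on orthogonal subspaces, since the union of
  orthonormal sets in two such subspaces is orthonormal.\<close>

definition orthonormal_dim :: "('i \<Rightarrow> complex) set \<Rightarrow> nat" where
  "orthonormal_dim W = Max {card B |B. finite B \<and> B \<subseteq> W \<and> orthonormal B}"

lemma ip_commute: "ip g f = cnj (ip f g)"
  by (simp add: ip_def mult.commute)

lemma ip_self: "ip f f = complex_of_real (\<Sum>i\<in>S. (cmod (f i))\<^sup>2)"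
  by (simp add: ip_def complex_norm_square flip: of_real_power)

lemma ip_self_eq_0D:
  assumes "f \<in> supported S" "ip f f = 0"
  shows "f = (\<lambda>i. 0)"
proof -
  have "(\<Sum>i\<in>S. (cmod (f i))\<^sup>2) = 0"
    using assms(2) unfolding ip_self by (simp only: of_real_eq_0_iff)
  then have "f i = 0" if "i \<in> S" for i
    using finite_S that by (simp add: sum_nonneg_eq_0_iff)
  then show ?thesis using assms(1) by (auto simp: supported_def)
qed

lemma ip_diff_left: "ip (\<lambda>i. f i - g i) h = ip f h - ip g h"
  by (simp add: ip_def algebra_simps sum_subtractf)

lemma ip_diff_right: "ip h (\<lambda>i. f i - g i) = ip h f - ip h g"
  by (simp add: ip_def algebra_simps sum_subtractf)

lemma ip_scale: "ip (\<lambda>i. c * f i) g = c * ip f g" "ip f (\<lambda>i. c * g i) = cnj c * ip f g"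
  by (simp_all add: ip_def sum_distrib_left algebra_simps)

lemma ip_proj_left: "ip (proj B f) g = (\<Sum>e\<in>B. ip f e * ip e g)"
  unfolding proj_def ip_def[of _ g]
  by (simp only: sum_distrib_left sum_distrib_right mult.assoc) (rule sum.swap)

lemma ip_proj_orthonormal:
  assumes "finite B" "orthonormal B" "d \<in> B"
  shows "ip (proj B f) d = ip f d"
proof -
  have "ip (proj B f) d = (\<Sum>e\<in>B. ip f e * (if e = d then 1 else 0))"
    unfolding ip_proj_left using assms(2,3) by (intro sum.cong) (auto simp: orthonormal_def)
  then show ?thesis using assms(1,3) by (simp add: if_distrib cong: if_cong)
qed

lemma ip_residual:
  assumes "finite B" "orthonormal B" "d \<in> B"
  shows "ip (\<lambda>i. f i - proj B f i) d = 0"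
  unfolding ip_diff_left using ip_proj_orthonormal[OF assms] by simp

text \<open>The residual \<open>f - proj B f\<close> is orthogonal to \<open>proj B f\<close>, so its squared norm is
  the difference of the two sides.\<close>

lemma Bessel:
  assumes B: "finite B" "orthonormal B"
  shows "(\<Sum>e\<in>B. (cmod (ip f e))\<^sup>2) \<le> (\<Sum>i\<in>S. (cmod (f i))\<^sup>2)"
proof -
  let ?r = "\<lambda>i. f i - proj B f i"
  have "ip (proj B f) ?r = 0"
    unfolding ip_proj_left using ip_residual[OF B, of _ f] by (simp add: ip_commute[of _ ?r])
  then have "ip ?r ?r = ip f ?r"
    unfolding ip_diff_left by simp
  also have "\<dots> = ip f f - cnj (ip (proj B f) f)"
    unfolding ip_diff_right using ip_commute[of "proj B f" f] by simp
  also have "ip (proj B f) f = complex_of_real (\<Sum>e\<in>B. (cmod (ip f e))\<^sup>2)"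
    unfolding ip_proj_left by (simp add: ip_commute[of _ f] complex_norm_square del: of_real_power)
  finally have "complex_of_real (\<Sum>i\<in>S. (cmod (?r i))\<^sup>2) =
      complex_of_real ((\<Sum>i\<in>S. (cmod (f i))\<^sup>2) - (\<Sum>e\<in>B. (cmod (ip f e))\<^sup>2))"
    unfolding ip_self by (simp only: complex_cnj_complex_of_real of_real_diff)
  then have "(\<Sum>i\<in>S. (cmod (?r i))\<^sup>2) = (\<Sum>i\<in>S. (cmod (f i))\<^sup>2) - (\<Sum>e\<in>B. (cmod (ip f e))\<^sup>2)"
    by (simp only: of_real_eq_iff)
  moreover have "(\<Sum>i\<in>S. (cmod (?r i))\<^sup>2) \<ge> 0" by (intro sum_nonneg) auto
  ultimately show ?thesis by linarith
qed

text \<open>Bessel's inequality for the indicator function of a point \<open>i\<close> bounds \<open>\<Sum>e\<in>B. (cmod (e i))\<^sup>2\<close>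
  by \<open>1\<close>. Summing over \<open>i\<close> and exchanging the sums bounds the number of unit vectors in \<open>B\<close>.\<close>

lemma card_orthonormal_le:
  assumes B: "finite B" "orthonormal B"
  shows "card B \<le> card S"
proof -
  have col: "(\<Sum>e\<in>B. (cmod (e i))\<^sup>2) \<le> 1" if i: "i \<in> S" for i
  proof -
    define \<delta> :: "'i \<Rightarrow> complex" where "\<delta> = (\<lambda>j. if j = i then 1 else 0)"
    have "ip \<delta> e = cnj (e i)" for e
      using i finite_S by (simp add: ip_def \<delta>_def if_distrib[of "\<lambda>x. x * _"] cong: if_cong)
    moreover have "(\<Sum>j\<in>S. (cmod (\<delta> j))\<^sup>2) = (\<Sum>j\<in>S. if j = i then 1 else 0)"
      by (intro sum.cong) (auto simp: \<delta>_def)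
    ultimately show ?thesis
      using Bessel[OF B, of \<delta>] i finite_S by simp
  qed
  have unit: "(\<Sum>i\<in>S. (cmod (e i))\<^sup>2) = 1" if "e \<in> B" for e
  proof -
    have "complex_of_real (\<Sum>i\<in>S. (cmod (e i))\<^sup>2) = complex_of_real 1"
      unfolding ip_self[symmetric] using B(2) that by (simp add: orthonormal_def)
    then show ?thesis by (simp only: of_real_eq_iff)
  qed
  have "real (card B) = (\<Sum>e\<in>B. \<Sum>i\<in>S. (cmod (e i))\<^sup>2)"
    using unit by simp
  also have "\<dots> = (\<Sum>i\<in>S. \<Sum>e\<in>B. (cmod (e i))\<^sup>2)" by (rule sum.swap)
  also have "\<dots> \<le> (\<Sum>i\<in>S. 1)" by (intro sum_mono col)
  finally show ?thesis by simp
qed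

lemma finite_card_orthonormal: "finite {card B |B. finite B \<and> B \<subseteq> W \<and> orthonormal B}"
  by (rule finite_subset[of _ "{..card S}"]) (auto simp: card_orthonormal_le)

lemma card_le_orthonormal_dim: "\<lbrakk>finite B; B \<subseteq> W; orthonormal B\<rbrakk> \<Longrightarrow> card B \<le> orthonormal_dim W"
  unfolding orthonormal_dim_def using finite_card_orthonormal by (intro Max_ge) auto

lemma orthonormal_dim_attained:
  obtains B where "finite B" "B \<subseteq> W" "orthonormal B" "card B = orthonormal_dim W"
proof -
  have "card {} \<in> {card B |B. finite B \<and> B \<subseteq> W \<and> orthonormal B}"
    by (intro CollectI exI[of _ "{}"]) (simp add: orthonormal_def)
  then have "orthonormal_dim W \<in> {card B |B. finite B \<and> B \<subseteq> W \<and> orthonormal B}"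
    unfolding orthonormal_dim_def using finite_card_orthonormal by (intro Max_in) auto
  then show ?thesis using that by auto
qed

lemma lin_subspace_supported: "lin_subspace (supported S)"
  by (auto simp: lin_subspace_def supported_def)

lemma lin_subspace_scale: "\<lbrakk>lin_subspace W; f \<in> W\<rbrakk> \<Longrightarrow> (\<lambda>i. c * f i) \<in> W"
  by (simp add: lin_subspace_def)

lemma lin_subspace_add: "\<lbrakk>lin_subspace W; f \<in> W; g \<in> W\<rbrakk> \<Longrightarrow> (\<lambda>i. f i + g i) \<in> W"
  by (simp add: lin_subspace_def)

lemma lin_subspace_diff:
  assumes W: "lin_subspace W" and "f \<in> W" "g \<in> W"
  shows "(\<lambda>i. f i - g i) \<in> W"
  using lin_subspace_add[OF W assms(2) lin_subspace_scale[OF W assms(3), of "-1"]] by simp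

lemma proj_in:
  assumes W: "lin_subspace W" and "finite B" "B \<subseteq> W"
  shows "proj B f \<in> W"
proof -
  have "(\<lambda>i. \<Sum>e\<in>B. c e * e i) \<in> W" for c
    using assms(2,3)
  proof (induction B)
    case empty
    then show ?case using W by (simp add: lin_subspace_def)
  next
    case (insert e B)
    then have "e \<in> W" "(\<lambda>i. \<Sum>e\<in>B. c e * e i) \<in> W" by auto
    from lin_subspace_add[OF W lin_subspace_scale[OF W this(1), of "c e"] this(2)]
    show ?case using insert.hyps by simp
  qed
  then show ?thesis unfolding proj_def .
qed

lemma normalize:
  assumes W: "lin_subspace W" and r: "r \<in> W" "r \<noteq> (\<lambda>i. 0)"
  obtains c where "ip (\<lambda>i. c * r i) (\<lambda>i. c * r i) = 1"
proof -
  define n where "n = (\<Sum>i\<in>S. (cmod (r i))\<^sup>2)"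
  have rr: "ip r r = complex_of_real n" unfolding n_def by (rule ip_self)
  have "n \<noteq> 0" using ip_self_eq_0D[of r] rr r W by (auto simp: lin_subspace_def)
  moreover have "n \<ge> 0" unfolding n_def by (intro sum_nonneg) auto
  ultimately have n: "n > 0" by simp
  have "ip (\<lambda>i. of_real (1 / sqrt n) * r i) (\<lambda>i. of_real (1 / sqrt n) * r i)
      = complex_of_real (1 / sqrt n * (1 / sqrt n) * n)"
    unfolding ip_scale rr by (simp only: complex_cnj_complex_of_real of_real_mult mult.assoc)
  also have "\<dots> = 1" using n by simp
  finally show ?thesis by (rule that)
qed

lemma orthonormal_Un:
  assumes "orthonormal B" "orthonormal C" "\<And>e d. \<lbrakk>e \<in> B; d \<in> C\<rbrakk> \<Longrightarrow> ip e d = 0"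
  shows "orthonormal (B \<union> C)" "B \<inter> C = {}"
proof -
  show *: "B \<inter> C = {}"
  proof (rule ccontr)
    assume "B \<inter> C \<noteq> {}"
    then obtain e where e: "e \<in> B" "e \<in> C" by blast
    then show False using assms(3)[OF e] assms(1) by (simp add: orthonormal_def)
  qed
  have "ip d e = 0" if "e \<in> B" "d \<in> C" for e d
    using assms(3)[OF that] ip_commute[of d e] by simp
  moreover have "e \<noteq> d" "d \<noteq> e" if "e \<in> B" "d \<in> C" for e d
    using * that by auto
  ultimately show "orthonormal (B \<union> C)"
    using assms unfolding orthonormal_def by (metis (no_types, lifting) Un_iff)
qed

text \<open>An orthonormal set of maximal size in \<open>W\<close> spans \<open>W\<close>: a nonzero residual of a vector of \<open>W\<close>
  could be normalized and added to the set.\<close>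

lemma orthonormal_basis:
  assumes W: "lin_subspace W"
  obtains B where "finite B" "B \<subseteq> W" "orthonormal B" "card B = orthonormal_dim W" "\<And>f. f \<in> W \<Longrightarrow> proj B f = f"
proof -
  obtain B where B: "finite B" "B \<subseteq> W" "orthonormal B" "card B = orthonormal_dim W"
    by (rule orthonormal_dim_attained)
  have "proj B f = f" if f: "f \<in> W" for f
  proof (rule ccontr)
    assume ne: "proj B f \<noteq> f"
    define r where "r = (\<lambda>i. f i - proj B f i)"
    have rW: "r \<in> W" unfolding r_def
      by (rule lin_subspace_diff[OF W f proj_in[OF W B(1,2)]])
    have "r \<noteq> (\<lambda>i. 0)" using ne unfolding r_def by (metis eq_iff_diff_eq_0 ext)
    then obtain c where c: "ip (\<lambda>i. c * r i) (\<lambda>i. c * r i) = 1"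
      using normalize[OF W rW] by blast
    let ?u = "\<lambda>i. c * r i"
    have "ip e ?u = 0" if "e \<in> B" for e
      using ip_residual[OF B(1,3) that, of f] ip_scale(1)[of c r e] ip_commute[of e ?u]
      unfolding r_def by simp
    moreover have "orthonormal {?u}" using c by (simp add: orthonormal_def)
    ultimately have "orthonormal (B \<union> {?u})" "B \<inter> {?u} = {}"
      using orthonormal_Un[OF B(3), of "{?u}"] by auto
    moreover have "?u \<in> W" by (rule lin_subspace_scale[OF W rW])
    ultimately have "card (B \<union> {?u}) \<le> orthonormal_dim W" "?u \<notin> B"
      using B card_le_orthonormal_dim[of "B \<union> {?u}" W] by auto
    then show False using B(1,4) by simp
  qed
  with B show ?thesis by (rule that)
qed

lemma orthonormal_dim_add_le:
  assumes "U \<subseteq> W" "U' \<subseteq> W" "\<And>u u'. \<lbrakk>u \<in> U; u' \<in> U'\<rbrakk> \<Longrightarrow> ip u u' = 0"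
  shows "orthonormal_dim U + orthonormal_dim U' \<le> orthonormal_dim W"
proof -
  obtain B where B: "finite B" "B \<subseteq> U" "orthonormal B" "card B = orthonormal_dim U"
    by (rule orthonormal_dim_attained)
  obtain C where C: "finite C" "C \<subseteq> U'" "orthonormal C" "card C = orthonormal_dim U'"
    by (rule orthonormal_dim_attained)
  have "orthonormal (B \<union> C)" "B \<inter> C = {}"
    using orthonormal_Un[OF B(3) C(3)] B(2) C(2) assms(3) by blast+
  moreover have "B \<union> C \<subseteq> W" using B(2) C(2) assms(1,2) by blast
  ultimately show ?thesis
    using card_le_orthonormal_dim[of "B \<union> C" W] B(1,4) C(1,4) by (simp add: card_Un_disjoint)
qed

lemma orthonormal_dim_pos:
  assumes W: "lin_subspace W" and r: "r \<in> W" "r \<noteq> (\<lambda>i. 0)"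
  shows "orthonormal_dim W > 0"
proof -
  obtain c where "ip (\<lambda>i. c * r i) (\<lambda>i. c * r i) = 1" using normalize[OF assms] .
  then have "card {\<lambda>i. c * r i} \<le> orthonormal_dim W"
    using lin_subspace_scale[OF W r(1)] by (intro card_le_orthonormal_dim) (auto simp: orthonormal_def)
  then show ?thesis by simp
qed

section \<open>Minimal separating invariant subspaces\<close>

lemma lin_subspace_complement:
  assumes "lin_subspace W" 
  shows "lin_subspace {w \<in> W. \<forall>u\<in>U. ip w u = 0}"
  using assms unfolding lin_subspace_def
  by (auto simp: ip_def distrib_right sum.distrib mult.assoc simp flip: sum_distrib_left)

text \<open>Among the invariant subspaces on which \<open>T p\<close> and \<open>T q\<close> still differ, take one of least
  dimension. If it had a proper nonzero invariant subspace \<open>U\<close>, then the orthogonal complement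
  \<open>U'\<close> of \<open>U\<close> in it would be invariant too, because \<open>A\<close> is closed under adjoints. Both are
  smaller, so \<open>T p\<close> and \<open>T q\<close> agree on \<open>U\<close> and on \<open>U'\<close>, hence on their sum, which is
  everything. This finds the irreducible constituent that matters without decomposing the whole
  space.\<close>

lemma minimal_separating_subspace:
  fixes T :: "'t \<Rightarrow> ('i \<Rightarrow> complex) \<Rightarrow> 'i \<Rightarrow> complex"
  assumes add: "\<And>t f g. T t (\<lambda>i. f i + g i) = (\<lambda>i. T t f i + T t g i)"
    and adjoint: "\<And>t. t \<in> A \<Longrightarrow> \<exists>t'\<in>A. \<forall>f\<in>supported S. \<forall>g\<in>supported S. ip (T t f) g = ip f (T t' g)"
    and supported: "\<And>t f. T t f \<in> supported S"
    and sep: "f0 \<in> supported S" "T p f0 \<noteq> T q f0"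
  obtains W where "lin_subspace W" "\<And>t f. \<lbrakk>t \<in> A; f \<in> W\<rbrakk> \<Longrightarrow> T t f \<in> W"
    "\<exists>f\<in>W. T p f \<noteq> T q f"
    "\<And>U. \<lbrakk>lin_subspace U; U \<subseteq> W; \<And>t f. \<lbrakk>t \<in> A; f \<in> U\<rbrakk> \<Longrightarrow> T t f \<in> U\<rbrakk> \<Longrightarrow> U = {\<lambda>i. 0} \<or> U = W"
proof -
  define P where "P W \<longleftrightarrow> lin_subspace W \<and> (\<forall>t\<in>A. \<forall>f\<in>W. T t f \<in> W) \<and> (\<exists>f\<in>W. T p f \<noteq> T q f)" for W
  have "P (supported S)" using lin_subspace_supported supported sep by (auto simp: P_def)
  then obtain W where W: "P W" "\<And>U. P U \<Longrightarrow> orthonormal_dim W \<le> orthonormal_dim U"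
    using ex_has_least_nat[of P "supported S" orthonormal_dim] by blast
  have Wsub: "lin_subspace W" and Winv: "\<And>t f. \<lbrakk>t \<in> A; f \<in> W\<rbrakk> \<Longrightarrow> T t f \<in> W"
    using W(1) by (auto simp: P_def)
  show ?thesis
  proof (rule that)
    fix U assume U: "lin_subspace U" "U \<subseteq> W" and Uinv: "\<And>t f. \<lbrakk>t \<in> A; f \<in> U\<rbrakk> \<Longrightarrow> T t f \<in> U"
    show "U = {\<lambda>i. 0} \<or> U = W"
    proof (rule ccontr)
      assume neg: "\<not> (U = {\<lambda>i. 0} \<or> U = W)"
      have "(\<lambda>i. 0) \<in> U" using U(1) by (simp add: lin_subspace_def)
      with neg obtain u where u: "u \<in> U" "u \<noteq> (\<lambda>i. 0)" by blast
      obtain w where w: "w \<in> W" "w \<notin> U" using neg U(2) by blast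
      define U' where "U' = {w \<in> W. \<forall>u\<in>U. ip w u = 0}"
      have U': "lin_subspace U'" "U' \<subseteq> W"
        unfolding U'_def by (auto intro: lin_subspace_complement[OF Wsub])
      obtain B where B: "finite B" "B \<subseteq> U" "orthonormal B" "\<And>f. f \<in> U \<Longrightarrow> proj B f = f"
        using orthonormal_basis[OF U(1)] by metis
      have res: "(\<lambda>i. f i - proj B f i) \<in> U'" if f: "f \<in> W" for f
      proof -
        have "ip (\<lambda>i. f i - proj B f i) g = 0" if g: "g \<in> U" for g
        proof -
          let ?r = "\<lambda>i. f i - proj B f i"
          have "ip (proj B g) ?r = 0"
            unfolding ip_proj_left
            using ip_residual[OF B(1,3), of _ f] by (simp add: ip_commute[of _ ?r])
          then show ?thesis using B(4)[OF g] ip_commute[of ?r g] by simp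
        qed
        moreover have "(\<lambda>i. f i - proj B f i) \<in> W"
          using lin_subspace_diff[OF Wsub f] proj_in[OF U(1) B(1,2)] U(2) by blast
        ultimately show ?thesis by (simp add: U'_def)
      qed
      have "(\<lambda>i. w i - proj B w i) \<noteq> (\<lambda>i. 0)"
      proof
        assume "(\<lambda>i. w i - proj B w i) = (\<lambda>i. 0)"
        then have "w = proj B w" by (auto simp: fun_eq_iff)
        then show False using w(2) proj_in[OF U(1) B(1,2), of w] by metis
      qed
      then have "orthonormal_dim U' > 0" using orthonormal_dim_pos[OF U'(1) res[OF w(1)]] by blast
      moreover have "orthonormal_dim U > 0" using orthonormal_dim_pos[OF U(1) u] .
      moreover have "orthonormal_dim U + orthonormal_dim U' \<le> orthonormal_dim W"
      proof (rule orthonormal_dim_add_le[OF U(2) U'(2)])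
        fix u u' assume "u \<in> U" "u' \<in> U'"
        then have "ip u' u = 0" by (simp add: U'_def)
        then show "ip u u' = 0" using ip_commute[of u u'] by simp
      qed
      ultimately have "\<not> P U" "\<not> P U'" using W(2)[of U] W(2)[of U'] by auto
      moreover have "T t f \<in> U'" if t: "t \<in> A" and f: "f \<in> U'" for t f
      proof -
        obtain t' where t': "t' \<in> A" "\<forall>f\<in>supported S. \<forall>g\<in>supported S. ip (T t f) g = ip f (T t' g)"
          using adjoint[OF t] by blast
        have "ip (T t f) g = 0" if "g \<in> U" for g
        proof -
          have "ip (T t f) g = ip f (T t' g)"
            using t'(2) f U'(1) U(1) that unfolding lin_subspace_def by (meson subsetD)
          also have "\<dots> = 0" using f Uinv[OF t'(1) that] by (simp add: U'_def)
          finally show ?thesis .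
        qed
        then show ?thesis using Winv[OF t] f by (simp add: U'_def)
      qed
      ultimately have same: "T p f = T q f" if "f \<in> U \<or> f \<in> U'" for f
        using U U' Uinv that unfolding P_def by metis
      have "T p f = T q f" if f: "f \<in> W" for f
      proof -
        let ?a = "proj B f" and ?b = "\<lambda>i. f i - proj B f i"
        have "T t f = (\<lambda>i. T t ?a i + T t ?b i)" for t
          using add[of t ?a ?b] by simp
        moreover have "T p ?a = T q ?a" "T p ?b = T q ?b"
          using same res[OF f] proj_in[OF U(1) B(1,2)] by blast+
        ultimately show ?thesis by simp
      qed
      then show False using W(1) by (auto simp: P_def)
    qed
  qed (use W(1) in \<open>auto simp: P_def\<close>)
qed

section \<open>Subspaces as Hilbert spaces\<close>

lemma complex_inner_space_function_space:
  assumes W: "lin_subspace W"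
  shows "complex_inner_space (function_space S W)"
proof -
  have cl: "(\<lambda>i. 0) \<in> W" "\<And>f g. f \<in> W \<Longrightarrow> g \<in> W \<Longrightarrow> (\<lambda>i. f i + g i) \<in> W"
    "\<And>c f. f \<in> W \<Longrightarrow> (\<lambda>i. c * f i) \<in> W"
    using W by (auto simp: lin_subspace_def)
  have neg: "\<exists>g\<in>W. (\<lambda>i. f i + g i) = (\<lambda>i. 0)" if "f \<in> W" for f
    using cl(3)[OF that, of "-1"] by (intro bexI[of _ "\<lambda>i. -1 * f i"]) auto
  have "abelian_group (function_space S W)"
    by (rule abelian_groupI) (auto simp: function_space_def cl neg algebra_simps)
  then have "Module.module complex_ring (function_space S W)"
    by (intro moduleI cring_from_type_algebra)
      (auto simp: function_space_def ring_of_type_algebra_def cl algebra_simps)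
  moreover have "ip f f \<noteq> 0" if "f \<in> W" "f \<noteq> (\<lambda>i. 0)" for f
    using ip_self_eq_0D[of f] that W by (auto simp: lin_subspace_def)
  ultimately show ?thesis
    unfolding complex_inner_space_def complex_inner_space_axioms_def
    by (auto simp: function_space_def ip_def sum_distrib_left sum.distrib algebra_simps
        simp del: mult_eq_0_iff intro!: add_nonneg_nonneg sum_nonneg)
qed

lemma uminus_function_space:
  assumes W: "lin_subspace W" and f: "f \<in> W"
  shows "\<ominus>\<^bsub>function_space S W\<^esub> f = (\<lambda>i. - f i)"
proof -
  interpret complex_inner_space "function_space S W"
    by (rule complex_inner_space_function_space[OF W])
  show ?thesis
    using f lin_subspace_scale[OF W f, of "-1"]
    by (intro M.minus_equality) (auto simp: function_space_def)
qed

lemma vdist_function_space: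
  assumes W: "lin_subspace W" and fg: "f \<in> W" "g \<in> W"
  shows "vdist (function_space S W) f g = sqrt (\<Sum>i\<in>S. (cmod (f i - g i))\<^sup>2)"
proof -
  have "f \<ominus>\<^bsub>function_space S W\<^esub> g = (\<lambda>i. f i - g i)"
    using uminus_function_space[OF W fg(2)] by (simp add: a_minus_def function_space_def)
  then show ?thesis
    using fg ip_self[of "\<lambda>i. f i - g i"]
    by (simp add: vdist_def vnorm_def function_space_def ip_def)
qed

text \<open>A Cauchy sequence in \<open>W\<close> converges in each coordinate. The limit stays in \<open>W\<close> because
  membership is the equation \<open>proj B f = f\<close> for an orthonormal basis \<open>B\<close>, and \<open>proj B\<close> is a finite
  expression in the coordinates.\<close>

lemma complex_hilbert_space_function_space:
  assumes W: "lin_subspace W"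
  shows "complex_hilbert_space (function_space S W)"
proof -
  let ?V = "function_space S W"
  interpret complex_inner_space ?V
    by (rule complex_inner_space_function_space[OF W])
  have car: "carrier ?V = W" by (simp add: function_space_def)
  obtain B where B: "finite B" "B \<subseteq> W" "\<And>f. f \<in> W \<Longrightarrow> proj B f = f"
    using orthonormal_basis[OF W] by metis
  have "\<exists>f. limitin metric.mtopology \<sigma> f sequentially" if \<sigma>: "metric.MCauchy \<sigma>" for \<sigma>
  proof -
    have "range \<sigma> \<subseteq> carrier ?V" using \<sigma> unfolding metric.MCauchy_def by blast
    then have \<sigma>W: "\<sigma> n \<in> W" for n by (auto simp: car)
    have coord: "cmod (\<sigma> m i - \<sigma> n i) \<le> vdist ?V (\<sigma> m) (\<sigma> n)" if "i \<in> S" for m n i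
      unfolding vdist_function_space[OF W \<sigma>W \<sigma>W]
      using that finite_S by (intro real_le_rsqrt member_le_sum) auto
    have "convergent (\<lambda>n. \<sigma> n i)" for i
    proof (cases "i \<in> S")
      case True
      have "Cauchy (\<lambda>n. \<sigma> n i)"
      proof (rule CauchyI)
        fix e :: real assume "e > 0"
        then obtain N where "\<And>m n. \<lbrakk>N \<le> m; N \<le> n\<rbrakk> \<Longrightarrow> vdist ?V (\<sigma> m) (\<sigma> n) < e"
          using \<sigma> unfolding metric.MCauchy_def by blast
        then show "\<exists>M. \<forall>m\<ge>M. \<forall>n\<ge>M. norm (\<sigma> m i - \<sigma> n i) < e"
          using coord[OF True] by (meson order_le_less_trans)
      qed
      then show ?thesis by (simp add: Cauchy_convergent_iff)
    next
      case False
      then have "\<sigma> n i = 0" for n using \<sigma>W[of n] W by (auto simp: lin_subspace_def supported_def)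
      then show ?thesis by (simp add: convergent_const)
    qed
    then obtain f where f: "\<And>i. (\<lambda>n. \<sigma> n i) \<longlonglongrightarrow> f i"
      unfolding convergent_def by metis
    have "(\<lambda>n. proj B (\<sigma> n) i) \<longlonglongrightarrow> proj B f i" for i
      unfolding proj_def ip_def by (intro tendsto_intros f)
    then have "(\<lambda>n. \<sigma> n i) \<longlonglongrightarrow> proj B f i" for i
      using B(3)[OF \<sigma>W] by simp
    then have "proj B f = f"
      using LIMSEQ_unique[OF _ f] by (intro ext) blast
    then have fW: "f \<in> W" using proj_in[OF W B(1,2), of f] by simp
    have "(\<lambda>n. sqrt (\<Sum>i\<in>S. (cmod (\<sigma> n i - f i))\<^sup>2)) \<longlonglongrightarrow> sqrt (\<Sum>i\<in>S. (cmod (f i - f i))\<^sup>2)"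
      by (intro tendsto_intros f)
    then have "(\<lambda>n. vdist ?V (\<sigma> n) f) \<longlonglongrightarrow> 0"
      by (simp add: vdist_function_space[OF W \<sigma>W fW])
    then show ?thesis
      using fW \<sigma>W unfolding metric.limitin_metric_dist_null by (intro exI[of _ f]) (simp add: car)
  qed
  then have "metric.mcomplete" by (simp add: metric.mcomplete_def)
  then show ?thesis
    by (simp add: complex_hilbert_space_def complex_hilbert_space_axioms_def complex_inner_space_axioms)
qed

lemma submodule_function_space:
  assumes W: "lin_subspace W" and U: "submodule U complex_ring (function_space S W)"
  shows "lin_subspace U" "U \<subseteq> W"
proof -
  interpret complex_inner_space "function_space S W"
    by (rule complex_inner_space_function_space[OF W])
  note sub = submoduleE[OF U]
  show UW: "U \<subseteq> W" using sub(1) by (simp add: function_space_def)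
  have add: "(\<lambda>i. f i + g i) \<in> U" if "f \<in> U" "g \<in> U" for f g
    using sub(5)[OF that] by (simp add: function_space_def)
  have scale: "(\<lambda>i. c * f i) \<in> U" if "f \<in> U" for c f
    using sub(4)[of c f] that by (simp add: function_space_def)
  obtain u where "u \<in> U" using sub(2) by blast
  from scale[OF this, of 0] have "(\<lambda>i. 0) \<in> U" by simp
  then show "lin_subspace U"
    using add scale UW W by (auto simp: lin_subspace_def)
qed

end

section \<open>The left regular representation of a finite group\<close>

text \<open>The index set of the functions is the copy \<open>{a} \<times> carrier F\<close> of the group. With \<open>F\<close> a group of
  natural numbers and \<open>a\<close> of the type of \<open>H\<close>, the functions on it have the type that carries the
  representations in the unitary dual of \<open>H\<close>.\<close>

locale left_regular = F: group F for F :: "('f, 'm) monoid_scheme" +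
  fixes a :: 'b
  assumes finite_F: "finite (carrier F)"
begin

abbreviation S :: "('b \<times> 'f) set" where
  "S \<equiv> {a} \<times> carrier F"

sublocale finite_support S
  by standard (simp add: finite_F)

definition translate :: "'f \<Rightarrow> ('b \<times> 'f \<Rightarrow> complex) \<Rightarrow> 'b \<times> 'f \<Rightarrow> complex" where
  "translate p f = (\<lambda>(b, t). if (b, t) \<in> S then f (a, inv\<^bsub>F\<^esub> p \<otimes>\<^bsub>F\<^esub> t) else 0)"

lemma translate_supported: "translate p f \<in> supported S"
  by (auto simp: translate_def supported_def)

lemma translate_add: "translate p (\<lambda>i. f i + g i) = (\<lambda>i. translate p f i + translate p g i)"
  by (auto simp: translate_def)

lemma translate_scale: "translate p (\<lambda>i. c * f i) = (\<lambda>i. c * translate p f i)"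
  by (auto simp: translate_def)

lemma translate_mult: "\<lbrakk>p \<in> carrier F; q \<in> carrier F\<rbrakk> \<Longrightarrow> translate (p \<otimes>\<^bsub>F\<^esub> q) f = translate p (translate q f)"
  by (auto simp: translate_def F.inv_mult_group F.m_assoc)

lemma translate_one: "f \<in> supported S \<Longrightarrow> translate \<one>\<^bsub>F\<^esub> f = f"
  by (auto simp: translate_def supported_def fun_eq_iff)

lemma translate_inv: "\<lbrakk>p \<in> carrier F; f \<in> supported S\<rbrakk> \<Longrightarrow> translate p (translate (inv\<^bsub>F\<^esub> p) f) = f"
  by (simp add: translate_one flip: translate_mult)

lemma ip_translate:
  assumes p: "p \<in> carrier F"
  shows "ip (translate p f) (translate p g) = ip f g"
  unfolding ip_def
  by (rule sum.reindex_bij_witness[of _ "\<lambda>(b, t). (b, p \<otimes>\<^bsub>F\<^esub> t)" "\<lambda>(b, t). (b, inv\<^bsub>F\<^esub> p \<otimes>\<^bsub>F\<^esub> t)"])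
    (use p in \<open>auto simp: translate_def F.inv_solve_left simp flip: F.m_assoc\<close>)

lemma translate_adjoint:
  assumes p: "p \<in> carrier F" and g: "g \<in> supported S"
  shows "ip (translate p f) g = ip f (translate (inv\<^bsub>F\<^esub> p) g)"
  using ip_translate[OF p, of f "translate (inv\<^bsub>F\<^esub> p) g"] translate_inv[OF p g] by simp

text \<open>The translates of the point mass at the unit are the point masses at \<open>p\<close> and \<open>q\<close>.\<close>

lemma translate_separates:
  assumes "p \<in> carrier F" "q \<in> carrier F" "p \<noteq> q"
  obtains f where "f \<in> supported S" "translate p f \<noteq> translate q f"
proof
  let ?\<delta> = "\<lambda>i. if i = (a, \<one>\<^bsub>F\<^esub>) then 1 else 0 :: complex"
  show "?\<delta> \<in> supported S" by (auto simp: supported_def)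
  have "inv\<^bsub>F\<^esub> q \<otimes>\<^bsub>F\<^esub> p \<noteq> \<one>\<^bsub>F\<^esub>" using assms by (metis F.inv_closed F.inv_equality F.inv_inv)
  then have "translate p ?\<delta> (a, p) \<noteq> translate q ?\<delta> (a, p)"
    using assms by (simp add: translate_def)
  then show "translate p ?\<delta> \<noteq> translate q ?\<delta>" by metis
qed

lemma restrict_translate_unitary:
  assumes W: "lin_subspace W" and p: "p \<in> carrier F"
    and inv: "\<And>f. f \<in> W \<Longrightarrow> translate p f \<in> W" "\<And>f. f \<in> W \<Longrightarrow> translate (inv\<^bsub>F\<^esub> p) f \<in> W"
  shows "restrict (translate p) W \<in> carrier (UnitaryGroup (function_space S W))"
proof -
  have sup: "f \<in> supported S" if "f \<in> W" for f
    using W that by (auto simp: lin_subspace_def)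
  have "bij_betw (translate p) W W"
    by (rule bij_betw_byWitness[where f' = "translate (inv\<^bsub>F\<^esub> p)"])
      (use inv translate_inv[OF p sup] translate_inv[OF F.inv_closed[OF p] sup] p in auto)
  then have bij: "bij_betw (restrict (translate p) W) W W"
    by (rule bij_betw_cong[THEN iffD1, rotated]) simp
  moreover have "ip (translate p f) (translate p g) = ip f g" for f g by (rule ip_translate[OF p])
  ultimately show ?thesis
    using lin_subspace_add[OF W] lin_subspace_scale[OF W]
    by (simp add: UnitaryGroup_def Bij_def unitary_map_def function_space_def translate_add translate_scale ip_def)
qed

text \<open>The representation is given as \<open>\<sigma> \<circ> \<pi>\<close>, not only as a representation of \<open>H\<close>: that its operator
  at \<open>h\<close> depends on \<open>\<pi> h\<close> alone is what makes its image and its orbit finite.\<close>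

lemma exists_separating_irreducible:
  assumes H: "group H" and \<pi>: "\<pi> \<in> hom H F"
    and xy: "x \<in> carrier H" "y \<in> carrier H" "\<pi> x \<noteq> \<pi> y"
  obtains V :: "('b \<times> 'f \<Rightarrow> complex) inner_space" and \<sigma>
  where "unitary_rep H V (\<lambda>h. \<sigma> (\<pi> h))" "irreducible_rep H V (\<lambda>h. \<sigma> (\<pi> h))"
    "\<sigma> (\<pi> x) \<noteq> \<sigma> (\<pi> y)"
proof -
  interpret H: group H by fact
  have \<pi>c: "\<pi> h \<in> carrier F" if "h \<in> carrier H" for h
    using \<pi> that by (auto simp: hom_def)
  have \<pi>inv: "inv\<^bsub>F\<^esub> \<pi> h = \<pi> (inv\<^bsub>H\<^esub> h)" if "h \<in> carrier H" for h
    using group_hom.hom_inv[of H F \<pi> h] that \<pi>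
    by (simp add: group_hom_def group_hom_axioms_def H F.group_axioms)
  obtain f0 where f0: "f0 \<in> supported S" "translate (\<pi> x) f0 \<noteq> translate (\<pi> y) f0"
    using translate_separates[OF \<pi>c[OF xy(1)] \<pi>c[OF xy(2)] xy(3)] .
  have adj: "\<exists>t'\<in>\<pi> ` carrier H. \<forall>f\<in>supported S. \<forall>g\<in>supported S. ip (translate t f) g = ip f (translate t' g)"
    if "t \<in> \<pi> ` carrier H" for t
    using that \<pi>c \<pi>inv translate_adjoint by (intro bexI[of _ "inv\<^bsub>F\<^esub> t"]) auto
  obtain W where W: "lin_subspace W" and inv: "\<And>t f. \<lbrakk>t \<in> \<pi> ` carrier H; f \<in> W\<rbrakk> \<Longrightarrow> translate t f \<in> W"
    and sep: "\<exists>f\<in>W. translate (\<pi> x) f \<noteq> translate (\<pi> y) f"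
    and irr: "\<And>U. \<lbrakk>lin_subspace U; U \<subseteq> W; \<And>t f. \<lbrakk>t \<in> \<pi> ` carrier H; f \<in> U\<rbrakk> \<Longrightarrow> translate t f \<in> U\<rbrakk>
      \<Longrightarrow> U = {\<lambda>i. 0} \<or> U = W"
    by (rule minimal_separating_subspace[of translate "\<pi> ` carrier H" f0 "\<pi> x" "\<pi> y"])
      (use adj translate_add translate_supported f0 in auto)
  let ?V = "function_space S W"
  define \<sigma> where "\<sigma> = (\<lambda>p. restrict (translate p) W)"
  have car: "carrier ?V = W" by (simp add: function_space_def)
  have unitary: "\<sigma> (\<pi> h) \<in> carrier (UnitaryGroup ?V)" if h: "h \<in> carrier H" for h
    unfolding \<sigma>_def
    by (rule restrict_translate_unitary[OF W \<pi>c[OF h]]) (use inv h \<pi>inv[OF h] in auto)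
  have "\<sigma> (\<pi> (g \<otimes>\<^bsub>H\<^esub> h)) = \<sigma> (\<pi> g) \<otimes>\<^bsub>UnitaryGroup ?V\<^esub> \<sigma> (\<pi> h)"
    if gh: "g \<in> carrier H" "h \<in> carrier H" for g h
  proof -
    have "\<sigma> (\<pi> g) \<in> Bij W" "\<sigma> (\<pi> h) \<in> Bij W"
      using unitary[OF gh(1)] unitary[OF gh(2)] by (auto simp: UnitaryGroup_def car)
    moreover have "\<sigma> (\<pi> (g \<otimes>\<^bsub>H\<^esub> h)) = compose W (\<sigma> (\<pi> g)) (\<sigma> (\<pi> h))"
      using \<pi> gh inv[of "\<pi> h"] translate_mult[OF \<pi>c[OF gh(1)] \<pi>c[OF gh(2)]]
      by (auto simp: \<sigma>_def compose_def hom_def restrict_def fun_eq_iff)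
    ultimately show ?thesis by (simp add: UnitaryGroup_def BijGroup_def car)
  qed
  then have rep: "unitary_rep H ?V (\<lambda>h. \<sigma> (\<pi> h))"
    using unitary complex_hilbert_space_function_space[OF W]
    by (auto simp: unitary_rep_def hom_def)
  have neq: "\<sigma> (\<pi> x) \<noteq> \<sigma> (\<pi> y)"
    using sep unfolding \<sigma>_def by (metis restrict_apply')
  have "W \<noteq> {\<lambda>i. 0}"
  proof
    assume "W = {\<lambda>i. 0}"
    moreover have "translate p (\<lambda>i. 0) = (\<lambda>i. 0)" for p by (auto simp: translate_def)
    ultimately show False using sep by simp
  qed
  moreover have "U = {\<lambda>i. 0} \<or> U = W"
    if "submodule U complex_ring ?V" and "\<forall>h\<in>carrier H. \<sigma> (\<pi> h) ` U \<subseteq> U" for U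
    using submodule_function_space[OF W that(1)] that(2)
    by (intro irr) (auto simp: \<sigma>_def image_subset_iff subset_iff)
  ultimately have irrep: "irreducible_rep H ?V (\<lambda>h. \<sigma> (\<pi> h))"
    by (auto simp: irreducible_rep_def car) (auto simp: function_space_def)
  show ?thesis by (rule that[OF rep irrep neq])
qed

end

section \<open>Actions on finite sets\<close>

lemma residually_finiteI:
  assumes "\<And>x y. \<lbrakk>x \<in> carrier G; y \<in> carrier G; x \<noteq> y\<rbrakk> \<Longrightarrow>
    \<exists>F :: nat monoid. group F \<and> finite (carrier F) \<and> (\<exists>\<phi>\<in>hom G F. \<phi> x \<noteq> \<phi> y)"
  shows "residually_finite G"
  using assms by (auto simp: residually_finite_def)

lemma finite_Bij:
  assumes "finite Q"
  shows "finite (Bij Q)"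
proof -
  have "Bij Q \<subseteq> PiE Q (\<lambda>_. Q)"
    using Bij_imp_funcset[of _ Q] Bij_imp_extensional[of _ Q] by (auto simp: PiE_def)
  then show ?thesis using assms by (meson finite_PiE finite_subset)
qed

lemma action_hom_BijGroup:
  assumes K: "group K"
    and closed: "\<And>k x. \<lbrakk>k \<in> carrier K; x \<in> Q\<rbrakk> \<Longrightarrow> A k x \<in> Q"
    and one: "\<And>x. x \<in> Q \<Longrightarrow> A \<one>\<^bsub>K\<^esub> x = x"
    and mult: "\<And>k l x. \<lbrakk>k \<in> carrier K; l \<in> carrier K; x \<in> Q\<rbrakk> \<Longrightarrow> A (k \<otimes>\<^bsub>K\<^esub> l) x = A k (A l x)"
  shows "(\<lambda>k. restrict (A k) Q) \<in> hom K (BijGroup Q)"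
proof -
  interpret K: group K by fact
  have Bij: "restrict (A k) Q \<in> Bij Q" if k: "k \<in> carrier K" for k
  proof -
    have "bij_betw (A k) Q Q"
      using k closed one mult[of "inv\<^bsub>K\<^esub> k" k] mult[of k "inv\<^bsub>K\<^esub> k"]
      by (intro bij_betw_byWitness[where f' = "A (inv\<^bsub>K\<^esub> k)"]) auto
    then have "bij_betw (restrict (A k) Q) Q Q"
      by (rule bij_betw_cong[THEN iffD1, rotated]) simp
    then show ?thesis by (simp add: Bij_def)
  qed
  then show ?thesis
    by (auto simp: hom_def BijGroup_def compose_def closed mult restrict_def fun_eq_iff)
qed

section \<open>Groups acting by automorphisms\<close>

locale automorphism_action = G: group G + H: group H + \<alpha>: group_hom G "AutoGroup H" \<alpha>
  for G :: "('g, 'm) monoid_scheme" and H :: "('h, 'n) monoid_scheme" and \<alpha> :: "'g \<Rightarrow> 'h \<Rightarrow> 'h"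
begin

abbreviation K :: "('h \<times> 'g) monoid" where
  "K \<equiv> semidirect_product H G \<alpha>"

abbreviation equivalence_class :: "'h rep \<Rightarrow> 'h rep set" where
  "equivalence_class r \<equiv> unitary_equivalence H `` {r}"

lemma \<alpha>_auto: "g \<in> carrier G \<Longrightarrow> \<alpha> g \<in> hom H H \<inter> Bij (carrier H)"
  using \<alpha>.hom_closed[of g] by (simp add: AutoGroup_def auto_def)

lemma \<alpha>_closed: "\<lbrakk>g \<in> carrier G; h \<in> carrier H\<rbrakk> \<Longrightarrow> \<alpha> g h \<in> carrier H"
  using \<alpha>_auto[of g] by (auto simp: hom_def)

lemma \<alpha>_mult:
  "\<lbrakk>g \<in> carrier G; h \<in> carrier H; h' \<in> carrier H\<rbrakk> \<Longrightarrow> \<alpha> g (h \<otimes>\<^bsub>H\<^esub> h') = \<alpha> g h \<otimes>\<^bsub>H\<^esub> \<alpha> g h'"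
  using \<alpha>_auto[of g] by (auto simp: hom_def)

lemma \<alpha>_image: "g \<in> carrier G \<Longrightarrow> \<alpha> g ` carrier H = carrier H"
  using \<alpha>_auto[of g] by (auto simp: Bij_def bij_betw_def)

lemma \<alpha>_comp:
  "\<lbrakk>g \<in> carrier G; g' \<in> carrier G; h \<in> carrier H\<rbrakk> \<Longrightarrow> \<alpha> (g \<otimes>\<^bsub>G\<^esub> g') h = \<alpha> g (\<alpha> g' h)"
  using \<alpha>.hom_mult[of g g'] \<alpha>_auto[of g] \<alpha>_auto[of g']
  by (simp add: AutoGroup_def BijGroup_def compose_def)

lemma \<alpha>_one: "h \<in> carrier H \<Longrightarrow> \<alpha> \<one>\<^bsub>G\<^esub> h = h"
  by (subst \<alpha>.hom_one) (simp add: AutoGroup_def BijGroup_def)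

lemma \<alpha>_undefined: "\<lbrakk>g \<in> carrier G; h \<notin> carrier H\<rbrakk> \<Longrightarrow> \<alpha> g h = undefined"
  using \<alpha>_auto[of g] by (auto simp: Bij_def extensional_def)

declare \<alpha>.hom_one [simp del] \<alpha>.hom_mult [simp del] \<alpha>.hom_inv [simp del]

lemma K_group: "group K"
  using G.group_axioms H.group_axioms \<alpha>.group_hom_axioms by (rule group_semidirect_product)

lemma H_hom_K: "(\<lambda>h. (h, \<one>\<^bsub>G\<^esub>)) \<in> hom H K"
  by (auto simp: hom_def semidirect_product_def \<alpha>_one)

lemma G_hom_K: "(\<lambda>g. (\<one>\<^bsub>H\<^esub>, g)) \<in> hom G K"
proof -
  have "\<alpha> g \<one>\<^bsub>H\<^esub> = \<one>\<^bsub>H\<^esub>" if "g \<in> carrier G" for g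
    using \<alpha>_auto[OF that] hom_one[OF _ H.group_axioms H.group_axioms] by auto
  then show ?thesis by (auto simp: hom_def semidirect_product_def)
qed

lemma K_hom_G: "snd \<in> hom K G"
  by (auto simp: hom_def semidirect_product_def)

text \<open>In the semidirect product the action becomes conjugation, so a homomorphism on \<open>K\<close> turns the
  action of \<open>g\<close> into conjugation by the image of \<open>g\<close>.\<close>

lemma conjugation_in_K:
  assumes "g \<in> carrier G" "h \<in> carrier H"
  shows "(\<alpha> g h, \<one>\<^bsub>G\<^esub>) = (\<one>\<^bsub>H\<^esub>, g) \<otimes>\<^bsub>K\<^esub> (h, \<one>\<^bsub>G\<^esub>) \<otimes>\<^bsub>K\<^esub> inv\<^bsub>K\<^esub> (\<one>\<^bsub>H\<^esub>, g)"
proof -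
  interpret K: group K by (rule K_group)
  have "(\<alpha> g h, \<one>\<^bsub>G\<^esub>) \<otimes>\<^bsub>K\<^esub> (\<one>\<^bsub>H\<^esub>, g) = (\<one>\<^bsub>H\<^esub>, g) \<otimes>\<^bsub>K\<^esub> (h, \<one>\<^bsub>G\<^esub>)"
    using assms by (simp add: semidirect_product_def \<alpha>_closed \<alpha>_one)
  moreover have "(\<alpha> g h, \<one>\<^bsub>G\<^esub>) \<in> carrier K" "(\<one>\<^bsub>H\<^esub>, g) \<in> carrier K" "(h, \<one>\<^bsub>G\<^esub>) \<in> carrier K"
    using assms by (auto simp: semidirect_product_def \<alpha>_closed)
  ultimately show ?thesis by (metis K.inv_solve_right K.m_closed)
qed

section \<open>The action on the dual\<close>

lemma rep_act_irreps:
  assumes g: "g \<in> carrier G" and r: "r \<in> irreps H"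
  shows "rep_act G \<alpha> g r \<in> irreps H"
proof -
  obtain V \<rho> where eq: "r = (V, \<rho>)" by (cases r)
  let ?a = "\<alpha> (inv\<^bsub>G\<^esub> g)"
  have rep: "unitary_rep H V \<rho>" and irr: "irreducible_rep H V \<rho>" using r by (auto simp: irreps_def eq)
  have "(\<lambda>h. \<rho> (?a h)) \<in> hom H (UnitaryGroup V)"
    using rep g by (auto simp: unitary_rep_def hom_def \<alpha>_closed \<alpha>_mult)
  moreover have "(\<forall>h\<in>carrier H. \<rho> (?a h) ` W \<subseteq> W) \<longleftrightarrow> (\<forall>h\<in>carrier H. \<rho> h ` W \<subseteq> W)" for W
    using \<alpha>_image[OF G.inv_closed[OF g]] by (metis (no_types, lifting) imageE image_eqI)
  then have "irreducible_rep H V (\<lambda>h. \<rho> (?a h))"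
    using irr by (simp add: irreducible_rep_def)
  ultimately show ?thesis
    using rep by (simp add: eq rep_act_def irreps_def unitary_rep_def)
qed

lemma rep_act_equivalence:
  assumes g: "g \<in> carrier G" and rs: "(r, s) \<in> unitary_equivalence H"
  shows "(rep_act G \<alpha> g r, rep_act G \<alpha> g s) \<in> unitary_equivalence H"
proof -
  obtain V \<rho> W \<sigma> where eq: "r = (V, \<rho>)" "s = (W, \<sigma>)" by (cases r, cases s)
  from rs obtain U where irr: "r \<in> irreps H" "s \<in> irreps H" and U: "unitary_map V W U"
    and tw: "\<And>h v. \<lbrakk>h \<in> carrier H; v \<in> carrier V\<rbrakk> \<Longrightarrow> U (\<rho> h v) = \<sigma> h (U v)"
    by (auto simp: unitary_equivalence_def eq)
  then have "\<forall>h\<in>carrier H. \<forall>v\<in>carrier V. U (\<rho> (\<alpha> (inv\<^bsub>G\<^esub> g) h) v) = \<sigma> (\<alpha> (inv\<^bsub>G\<^esub> g) h) (U v)"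
    using g \<alpha>_closed by (simp)
  then show ?thesis
    using U rep_act_irreps[OF g irr(1)] rep_act_irreps[OF g irr(2)]
    by (auto simp: eq rep_act_def unitary_equivalence_def)
qed

text \<open>The union over all representatives of a class in the definition of the action is a single
  class, since equivalent representations have equivalent translates.\<close>

lemma dual_act_class:
  assumes g: "g \<in> carrier G" and r: "r \<in> irreps H"
  shows "dual_act G H \<alpha> g (equivalence_class r) = equivalence_class (rep_act G \<alpha> g r)"
proof -
  note E = equiv_unitary_equivalence[of H]
  have "equivalence_class (rep_act G \<alpha> g s) = equivalence_class (rep_act G \<alpha> g r)"
    if "s \<in> equivalence_class r" for s
    using equiv_class_eq[OF E rep_act_equivalence[OF g, of r s]] that by auto
  moreover have "r \<in> equivalence_class r"
    using equiv_class_self[OF E r] .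
  ultimately show ?thesis unfolding dual_act_def by blast
qed

text \<open>A finite quotient \<open>\<phi>\<close> of \<open>K\<close> with \<open>\<phi> x \<noteq> \<phi> y\<close> restricts to \<open>\<pi>\<close> on \<open>H\<close> and \<open>\<kappa>\<close> on \<open>G\<close>. Take an
  irreducible representation \<open>\<sigma> \<circ> \<pi>\<close> separating \<open>x\<close> and \<open>y\<close>. Its translate by \<open>g\<close> sends \<open>h\<close> to
  \<open>\<sigma>\<close> of the conjugate of \<open>\<pi> h\<close> by the inverse of \<open>\<kappa> g\<close>, so there are at most as many translates
  as values of \<open>\<kappa>\<close>, and these lie in a finite group.\<close>

lemma separates_if_semidirect_product_residually_finite:
  assumes rf: "residually_finite K"
  shows "separates_points
      {c \<in> unitary_dual H. has_finite_image H c \<and> finite (orbit G (dual_act G H \<alpha>) c)} H"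
  unfolding separates_points_def
proof (intro ballI impI)
  fix x y assume xy: "x \<in> carrier H" "y \<in> carrier H" "x \<noteq> y"
  have "(x, \<one>\<^bsub>G\<^esub>) \<in> carrier K" "(y, \<one>\<^bsub>G\<^esub>) \<in> carrier K" "(x, \<one>\<^bsub>G\<^esub>) \<noteq> (y, \<one>\<^bsub>G\<^esub>)"
    using xy by (auto simp: semidirect_product_def)
  then obtain F :: "nat monoid" and \<phi> where F: "group F" "finite (carrier F)"
    and \<phi>: "\<phi> \<in> hom K F" and sep: "\<phi> (x, \<one>\<^bsub>G\<^esub>) \<noteq> \<phi> (y, \<one>\<^bsub>G\<^esub>)"
    using rf unfolding residually_finite_def by blast
  interpret F: group F by fact
  interpret left_regular F "undefined :: 'h"
    by unfold_locales (rule F(2))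
  interpret \<phi>: group_hom K F \<phi>
    using K_group F.group_axioms \<phi> by (simp add: group_hom_def group_hom_axioms_def)
  define \<pi> where "\<pi> h = \<phi> (h, \<one>\<^bsub>G\<^esub>)" for h
  define \<kappa> where "\<kappa> g = \<phi> (\<one>\<^bsub>H\<^esub>, g)" for g
  have "\<pi> = \<phi> \<circ> (\<lambda>h. (h, \<one>\<^bsub>G\<^esub>))" by (simp add: \<pi>_def fun_eq_iff)
  then have \<pi>: "\<pi> \<in> hom H F"
    using hom_compose[OF H_hom_K \<phi>] by simp
  obtain V :: "'h rep_space inner_space" and \<sigma> where rep: "unitary_rep H V (\<lambda>h. \<sigma> (\<pi> h))"
    and irr: "irreducible_rep H V (\<lambda>h. \<sigma> (\<pi> h))" and \<sigma>: "\<sigma> (\<pi> x) \<noteq> \<sigma> (\<pi> y)"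
    using exists_separating_irreducible[OF H.group_axioms \<pi> xy(1,2)] sep
    by (auto simp: \<pi>_def)
  define r where "r = (V, \<lambda>h. \<sigma> (\<pi> h))"
  have r: "r \<in> irreps H" using rep irr by (simp add: r_def irreps_def)
  let ?c = "equivalence_class r"
  have rc: "r \<in> ?c" using equiv_class_self[OF equiv_unitary_equivalence r] .
  have "\<pi> ` carrier H \<subseteq> carrier F" using \<pi> by (auto simp: hom_def)
  then have "finite (\<sigma> ` \<pi> ` carrier H)" using F(2) by (meson finite_imageI finite_subset)
  then have image: "has_finite_image H ?c"
    using rc unfolding has_finite_image_def by (intro bexI[of _ r]) (simp_all add: r_def image_image)
  have conj: "\<pi> (\<alpha> (inv\<^bsub>G\<^esub> g) h) = inv\<^bsub>F\<^esub> \<kappa> g \<otimes>\<^bsub>F\<^esub> \<pi> h \<otimes>\<^bsub>F\<^esub> \<kappa> g"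
    if g: "g \<in> carrier G" and h: "h \<in> carrier H" for g h
  proof -
    have in_K: "(\<one>\<^bsub>H\<^esub>, g) \<in> carrier K" "(\<one>\<^bsub>H\<^esub>, inv\<^bsub>G\<^esub> g) \<in> carrier K" "(h, \<one>\<^bsub>G\<^esub>) \<in> carrier K"
      using g h by (auto simp: semidirect_product_def)
    have "(\<one>\<^bsub>H\<^esub>, inv\<^bsub>G\<^esub> g) = inv\<^bsub>K\<^esub> (\<one>\<^bsub>H\<^esub>, g)"
      using group_hom.hom_inv[of G K "\<lambda>g. (\<one>\<^bsub>H\<^esub>, g)" g] G_hom_K K_group G.group_axioms g
      by (simp add: group_hom_def group_hom_axioms_def)
    then show ?thesis
      using conjugation_in_K[OF G.inv_closed[OF g] h] in_K
      by (simp add: \<pi>_def \<kappa>_def)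
  qed
  have same: "rep_act G \<alpha> g r = rep_act G \<alpha> g' r"
    if "g \<in> carrier G" "g' \<in> carrier G" "\<kappa> g = \<kappa> g'" for g g'
  proof -
    \<comment> \<open>Outside the carrier of \<open>H\<close> all automorphisms take the value \<open>undefined\<close>, so the two
      translates are equal as functions and not only on the carrier.\<close>
    have "\<pi> (\<alpha> (inv\<^bsub>G\<^esub> g) h) = \<pi> (\<alpha> (inv\<^bsub>G\<^esub> g') h)" for h
      using conj[of g h] conj[of g' h] that \<alpha>_undefined[of "inv\<^bsub>G\<^esub> g" h] \<alpha>_undefined[of "inv\<^bsub>G\<^esub> g'" h]
      by (cases "h \<in> carrier H") simp_all
    then show ?thesis by (simp add: rep_act_def r_def)
  qed
  have "orbit G (dual_act G H \<alpha>) ?c =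
      (\<lambda>p. equivalence_class (rep_act G \<alpha> (inv_into (carrier G) \<kappa> p) r)) ` \<kappa> ` carrier G"
  proof -
    have "rep_act G \<alpha> (inv_into (carrier G) \<kappa> (\<kappa> g)) r = rep_act G \<alpha> g r" if "g \<in> carrier G" for g
      using that by (intro same) (auto simp: inv_into_into f_inv_into_f)
    then show ?thesis
      using dual_act_class[OF _ r] by (auto simp: orbit_def image_image)
  qed
  moreover have "\<kappa> ` carrier G \<subseteq> carrier F"
    by (auto simp: \<kappa>_def semidirect_product_def intro!: \<phi>.hom_closed)
  ultimately have "finite (orbit G (dual_act G H \<alpha>) ?c)"
    using F(2) by (metis finite_imageI finite_subset)
  moreover have "?c \<in> unitary_dual H" unfolding unitary_dual_def using r by (rule quotientI)
  ultimately show "\<exists>c\<in>{c \<in> unitary_dual H. has_finite_image H c \<and> finite (orbit G (dual_act G H \<alpha>) c)}.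
      \<exists>(V, \<rho>)\<in>c. \<rho> x \<noteq> \<rho> y"
    using image rc \<sigma> by (intro bexI[of _ ?c] bexI[of _ r]) (auto simp: r_def)
qed

section \<open>Finite quotients from finite orbits\<close>

text \<open>For a representation \<open>\<rho>\<close> this is congruence modulo the intersection of the kernels of all
  translates of \<open>\<rho>\<close>, the largest \<open>G\<close>-invariant normal subgroup inside the kernel of \<open>\<rho>\<close>.\<close>

definition orbit_relation :: "('h \<Rightarrow> 'b) \<Rightarrow> 'h rel" where
  "orbit_relation \<rho> = {(u, v). u \<in> carrier H \<and> v \<in> carrier H \<and>
     (\<forall>g\<in>carrier G. \<rho> (\<alpha> g u) = \<rho> (\<alpha> g v))}"

lemma equiv_orbit_relation: "equiv (carrier H) (orbit_relation \<rho>)"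
  by (intro equivI refl_onI symI transI) (auto simp: orbit_relation_def)

text \<open>Whether a translate of \<open>\<rho>\<close> identifies \<open>u\<close> and \<open>v\<close> depends only on its equivalence class. So it
  is enough to test one translate for each class in the finite orbit, and each of them takes only
  finitely many values.\<close>

lemma finite_quotient_orbit_relation:
  assumes irr: "(V, \<rho>) \<in> irreps H" and image: "finite (\<rho> ` carrier H)"
    and orb: "finite (orbit G (dual_act G H \<alpha>) (equivalence_class (V, \<rho>)))"
  shows "finite (carrier H // orbit_relation \<rho>)"
proof -
  let ?O = "orbit G (dual_act G H \<alpha>) (equivalence_class (V, \<rho>))"
  let ?R = "orbit_relation \<rho>"
  have "\<forall>d\<in>?O. \<exists>k\<in>carrier G. d = equivalence_class (rep_act G \<alpha> k (V, \<rho>))"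
    using dual_act_class[OF _ irr] by (auto simp: orbit_def)
  then obtain k where k: "\<And>d. d \<in> ?O \<Longrightarrow> k d \<in> carrier G"
    "\<And>d. d \<in> ?O \<Longrightarrow> d = equivalence_class (rep_act G \<alpha> (k d) (V, \<rho>))"
    by metis
  define f where "f u = (\<lambda>d\<in>?O. \<rho> (\<alpha> (inv\<^bsub>G\<^esub> k d) u))" for u
  have "f ` carrier H \<subseteq> PiE ?O (\<lambda>_. \<rho> ` carrier H)"
    using k(1) \<alpha>_closed by (auto simp: f_def)
  then have fin: "finite (f ` carrier H)"
    using orb image by (meson finite_PiE finite_subset)
  have R: "(u, v) \<in> ?R" if uv: "u \<in> carrier H" "v \<in> carrier H" "f u = f v" for u v
  proof -
    have "\<rho> (\<alpha> g u) = \<rho> (\<alpha> g v)" if g: "g \<in> carrier G" for g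
    proof -
      define d where "d = equivalence_class (rep_act G \<alpha> (inv\<^bsub>G\<^esub> g) (V, \<rho>))"
      have d: "d \<in> ?O"
        using dual_act_class[OF G.inv_closed[OF g] irr] g by (auto simp: d_def orbit_def)
      have "(rep_act G \<alpha> (k d) (V, \<rho>), rep_act G \<alpha> (inv\<^bsub>G\<^esub> g) (V, \<rho>)) \<in> unitary_equivalence H"
        using trans[OF k(2)[OF d, symmetric] d_def] equiv_unitary_equivalence
          rep_act_irreps[OF G.inv_closed[OF g] irr] by (rule eq_equiv_class)
      then have "((V, \<lambda>h. \<rho> (\<alpha> (inv\<^bsub>G\<^esub> k d) h)), (V, \<lambda>h. \<rho> (\<alpha> g h))) \<in> unitary_equivalence H"
        using g by (simp add: rep_act_def)
      moreover have "\<rho> (\<alpha> (inv\<^bsub>G\<^esub> k d) u) = \<rho> (\<alpha> (inv\<^bsub>G\<^esub> k d) v)"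
        using fun_cong[OF uv(3), of d] d by (simp add: f_def)
      ultimately show ?thesis using separates_cong[OF _ uv(1,2)] by blast
    qed
    then show ?thesis using uv by (simp add: orbit_relation_def)
  qed
  have "?R `` {inv_into (carrier H) f (f u)} = ?R `` {u}" if "u \<in> carrier H" for u
    using that by (intro equiv_class_eq[OF equiv_orbit_relation] R) (auto simp: inv_into_into f_inv_into_f)
  then have "(\<lambda>z. ?R `` {inv_into (carrier H) f z}) ` f ` carrier H = (\<lambda>u. ?R `` {u}) ` carrier H"
    unfolding image_image by (rule image_cong[OF refl])
  also have "\<dots> = carrier H // ?R" by (auto simp: quotient_def)
  finally show ?thesis using fin by (metis finite_imageI)
qed

text \<open>This is left translation by \<open>K\<close> on its cosets modulo \<open>G\<close>, where each coset is named by its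
  unique element in \<open>H\<close>.\<close>

definition affine_act :: "'h \<times> 'g \<Rightarrow> 'h \<Rightarrow> 'h" where
  "affine_act k u = fst k \<otimes>\<^bsub>H\<^esub> \<alpha> (snd k) u"

lemma affine_act_closed: "\<lbrakk>k \<in> carrier K; u \<in> carrier H\<rbrakk> \<Longrightarrow> affine_act k u \<in> carrier H"
  by (auto simp: affine_act_def semidirect_product_def \<alpha>_closed)

lemma affine_act_one: "u \<in> carrier H \<Longrightarrow> affine_act \<one>\<^bsub>K\<^esub> u = u"
  by (simp add: affine_act_def semidirect_product_def \<alpha>_one)

lemma affine_act_mult:
  "\<lbrakk>k \<in> carrier K; l \<in> carrier K; u \<in> carrier H\<rbrakk> \<Longrightarrow> affine_act (k \<otimes>\<^bsub>K\<^esub> l) u = affine_act k (affine_act l u)"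
  by (auto simp: affine_act_def semidirect_product_def \<alpha>_closed \<alpha>_mult \<alpha>_comp H.m_assoc)

text \<open>The affine action permutes the finitely many classes of \<open>R\<close>, which is a homomorphism to a finite
  permutation group. The permutations of \<open>(x, g)\<close> and \<open>(y, g)\<close> send the class of the unit to the
  classes of \<open>x\<close> and of \<open>y\<close>.\<close>

lemma separated_by_invariant_relation:
  assumes R: "equiv (carrier H) R" and fin: "finite (carrier H // R)"
    and inv: "\<And>k u v. \<lbrakk>k \<in> carrier K; (u, v) \<in> R\<rbrakk> \<Longrightarrow> (affine_act k u, affine_act k v) \<in> R"
    and xy: "x \<in> carrier H" "y \<in> carrier H" "(x, y) \<notin> R" and g: "g \<in> carrier G"
  shows "\<exists>F :: nat monoid. group F \<and> finite (carrier F) \<and> (\<exists>\<phi>\<in>hom K F. \<phi> (x, g) \<noteq> \<phi> (y, g))"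
proof -
  interpret K: group K by (rule K_group)
  let ?Q = "carrier H // R"
  have sub: "C \<subseteq> carrier H" if "C \<in> ?Q" for C
    using that R by (rule in_quotient_imp_subset[rotated])
  have class_image: "affine_act k ` (R `` {u}) = R `` {affine_act k u}"
    if k: "k \<in> carrier K" and u: "u \<in> carrier H" for k u
  proof (intro equalityI subsetI)
    fix w assume "w \<in> affine_act k ` (R `` {u})"
    then show "w \<in> R `` {affine_act k u}" using inv[OF k] by auto
  next
    fix w assume "w \<in> R `` {affine_act k u}"
    then have w: "(affine_act k u, w) \<in> R" by simp
    then have wH: "w \<in> carrier H" using R by (meson equiv_class_eq_iff)
    have "affine_act (inv\<^bsub>K\<^esub> k) (affine_act k u) = u" "affine_act k (affine_act (inv\<^bsub>K\<^esub> k) w) = w"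
      using k u wH by (simp_all add: affine_act_one flip: affine_act_mult)
    moreover have "(affine_act (inv\<^bsub>K\<^esub> k) (affine_act k u), affine_act (inv\<^bsub>K\<^esub> k) w) \<in> R"
      using inv[OF K.inv_closed[OF k] w] .
    ultimately show "w \<in> affine_act k ` (R `` {u})" by (metis Image_singleton_iff image_eqI)
  qed
  let ?\<phi> = "\<lambda>k. restrict ((`) (affine_act k)) ?Q"
  have hom: "?\<phi> \<in> hom K (BijGroup ?Q)"
  proof (rule action_hom_BijGroup[OF K_group])
    fix k C assume "k \<in> carrier K" "C \<in> ?Q"
    then show "affine_act k ` C \<in> ?Q"
      by (auto elim!: quotientE simp: class_image affine_act_closed intro!: quotientI)
  next
    fix C assume "C \<in> ?Q"
    then show "affine_act \<one>\<^bsub>K\<^esub> ` C = C" using sub affine_act_one by (force simp: subset_iff)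
  next
    fix k l C assume "k \<in> carrier K" "l \<in> carrier K" "C \<in> ?Q"
    then show "affine_act (k \<otimes>\<^bsub>K\<^esub> l) ` C = affine_act k ` affine_act l ` C"
      using sub[of C] unfolding image_image by (intro image_cong refl affine_act_mult) auto
  qed
  have in_K: "(z, g) \<in> carrier K" if "z \<in> carrier H" for z
    using that g by (simp add: semidirect_product_def)
  have "?\<phi> (x, g) \<noteq> ?\<phi> (y, g)"
  proof
    assume eq: "?\<phi> (x, g) = ?\<phi> (y, g)"
    have one: "R `` {\<one>\<^bsub>H\<^esub>} \<in> ?Q" by (intro quotientI H.one_closed)
    have "affine_act (z, g) \<one>\<^bsub>H\<^esub> = z" if "z \<in> carrier H" for z
      using that g \<alpha>_auto[OF g] hom_one[OF _ H.group_axioms H.group_axioms, of "\<alpha> g"]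
      by (simp add: affine_act_def)
    then have "?\<phi> (z, g) (R `` {\<one>\<^bsub>H\<^esub>}) = R `` {z}" if "z \<in> carrier H" for z
      using that one class_image[OF in_K[OF that] H.one_closed] by simp
    then have "R `` {x} = R `` {y}" using fun_cong[OF eq] xy by metis
    then show False using xy eq_equiv_class_iff[OF R] by blast
  qed
  moreover have "finite (carrier (BijGroup ?Q))"
    using finite_Bij[OF fin] by (simp add: BijGroup_def)
  ultimately show ?thesis
    by (intro separated_by_finite_group[OF group_BijGroup _ hom] in_K xy)
qed

text \<open>Multiplicativity splits the value of a translate of \<open>\<rho>\<close> at \<open>affine_act k u\<close> into a factor that
  does not involve \<open>u\<close> and the value of another translate at \<open>u\<close>.\<close>

lemma orbit_relation_affine:
  assumes \<rho>: "\<rho> \<in> hom H U" and k: "k \<in> carrier K" and uv: "(u, v) \<in> orbit_relation \<rho>"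
  shows "(affine_act k u, affine_act k v) \<in> orbit_relation \<rho>"
proof -
  obtain h g where hg: "k = (h, g)" "h \<in> carrier H" "g \<in> carrier G"
    using k by (auto simp: semidirect_product_def)
  have uvH: "u \<in> carrier H" "v \<in> carrier H" using uv by (auto simp: orbit_relation_def)
  have "\<rho> (\<alpha> g' (affine_act k w)) = \<rho> (\<alpha> g' h) \<otimes>\<^bsub>U\<^esub> \<rho> (\<alpha> (g' \<otimes>\<^bsub>G\<^esub> g) w)"
    if "g' \<in> carrier G" "w \<in> carrier H" for g' w
    using that hg \<rho> by (simp add: affine_act_def hom_def \<alpha>_closed \<alpha>_mult \<alpha>_comp)
  then show ?thesis
    using uv uvH affine_act_closed[OF k] hg(3) by (auto simp: orbit_relation_def)
qed

text \<open>Elements with different components in \<open>G\<close> are separated by a finite quotient of \<open>G\<close>. Elements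
  \<open>(x, g)\<close> and \<open>(y, g)\<close> are separated by the permutation action on the classes of
  \<open>orbit_relation \<rho>\<close>, for a representation \<open>\<rho>\<close> of finite orbit with \<open>\<rho> x \<noteq> \<rho> y\<close>.\<close>

lemma semidirect_product_residually_finite_if_separates:
  assumes G_rf: "residually_finite G"
    and sep: "separates_points
      {c \<in> unitary_dual H. has_finite_image H c \<and> finite (orbit G (dual_act G H \<alpha>) c)} H"
  shows "residually_finite K"
proof (rule residually_finiteI)
  fix k l assume kl: "k \<in> carrier K" "l \<in> carrier K" "k \<noteq> l"
  obtain x g y g' where eq: "k = (x, g)" "l = (y, g')" by (cases k, cases l)
  have in_HG: "x \<in> carrier H" "y \<in> carrier H" "g \<in> carrier G" "g' \<in> carrier G"
    using kl eq by (auto simp: semidirect_product_def)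
  show "\<exists>F :: nat monoid. group F \<and> finite (carrier F) \<and> (\<exists>\<phi>\<in>hom K F. \<phi> k \<noteq> \<phi> l)"
  proof (cases "g = g'")
    case False
    then obtain F :: "nat monoid" and \<phi> where F: "group F" "finite (carrier F)" "\<phi> \<in> hom G F" "\<phi> g \<noteq> \<phi> g'"
      using G_rf in_HG unfolding residually_finite_def by blast
    then have "\<phi> \<circ> snd \<in> hom K F" "(\<phi> \<circ> snd) k \<noteq> (\<phi> \<circ> snd) l"
      using hom_compose[OF K_hom_G F(3)] eq by auto
    then show ?thesis using F(1,2) by blast
  next
    case True
    then have "x \<noteq> y" using kl(3) eq by simp
    then obtain c V \<rho> where c: "c \<in> unitary_dual H" "has_finite_image H c"
        "finite (orbit G (dual_act G H \<alpha>) c)" and V: "(V, \<rho>) \<in> c" "\<rho> x \<noteq> \<rho> y"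
      using sep in_HG unfolding separates_points_def by blast
    obtain s where s: "s \<in> irreps H" "c = equivalence_class s"
      using c(1) unfolding unitary_dual_def by (rule quotientE)
    then have s_V: "(s, (V, \<rho>)) \<in> unitary_equivalence H" using V(1) by simp
    then have irr: "(V, \<rho>) \<in> irreps H" by (auto simp: unitary_equivalence_def)
    have c_eq: "c = equivalence_class (V, \<rho>)"
      using equiv_class_eq[OF equiv_unitary_equivalence s_V] s(2) by simp
    obtain V' \<rho>' where "(V', \<rho>') \<in> c" "finite (\<rho>' ` carrier H)"
      using c(2) by (auto simp: has_finite_image_def)
    then have image: "finite (\<rho> ` carrier H)"
      using finite_image_cong[of V \<rho> V' \<rho>' H] by (auto simp: c_eq)
    have "(x, y) \<notin> orbit_relation \<rho>"
    proof
      assume "(x, y) \<in> orbit_relation \<rho>"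
      then have "\<rho> (\<alpha> \<one>\<^bsub>G\<^esub> x) = \<rho> (\<alpha> \<one>\<^bsub>G\<^esub> y)" unfolding orbit_relation_def by blast
      then show False using V(2) in_HG by (simp add: \<alpha>_one)
    qed
    moreover have "finite (carrier H // orbit_relation \<rho>)"
      using finite_quotient_orbit_relation[OF irr image] c(3) by (simp add: c_eq)
    moreover have "\<rho> \<in> hom H (UnitaryGroup V)" using irr by (simp add: irreps_def unitary_rep_def)
    ultimately show ?thesis
      unfolding eq True[symmetric] using in_HG
      by (intro separated_by_invariant_relation[OF equiv_orbit_relation _ orbit_relation_affine])
  qed
qed

lemma acting_group_residually_finite:
  assumes rf: "residually_finite K"
  shows "residually_finite G"
proof (rule residually_finiteI)
  fix g g' assume g: "g \<in> carrier G" "g' \<in> carrier G" "g \<noteq> g'"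
  then have "(\<one>\<^bsub>H\<^esub>, g) \<in> carrier K" "(\<one>\<^bsub>H\<^esub>, g') \<in> carrier K" "(\<one>\<^bsub>H\<^esub>, g) \<noteq> (\<one>\<^bsub>H\<^esub>, g')"
    by (auto simp: semidirect_product_def)
  then obtain F :: "nat monoid" and \<phi> where F: "group F" "finite (carrier F)" "\<phi> \<in> hom K F"
      "\<phi> (\<one>\<^bsub>H\<^esub>, g) \<noteq> \<phi> (\<one>\<^bsub>H\<^esub>, g')"
    using rf unfolding residually_finite_def by blast
  then show "\<exists>F :: nat monoid. group F \<and> finite (carrier F) \<and> (\<exists>\<phi>\<in>hom G F. \<phi> g \<noteq> \<phi> g')"
    using hom_compose[OF G_hom_K F(3)]
    by (intro exI[of _ F] conjI bexI[of _ "\<phi> \<circ> (\<lambda>g. (\<one>\<^bsub>H\<^esub>, g))"]) auto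
qed

end

theorem proposition4p6:
  fixes G :: "('g, 'm) monoid_scheme" and H :: "('h, 'n) monoid_scheme"
    and \<alpha> :: "'g \<Rightarrow> 'h \<Rightarrow> 'h"
  assumes "group G" and "group H" and "group_hom G (AutoGroup H) \<alpha>"
  shows "residually_finite (semidirect_product H G \<alpha>) \<longleftrightarrow>
    residually_finite G \<and>
    separates_points
      {c \<in> unitary_dual H. has_finite_image H c \<and> finite (orbit G (dual_act G H \<alpha>) c)} H"
proof -
  interpret automorphism_action G H \<alpha>
    using assms by (simp add: automorphism_action_def)
  show ?thesis
    using acting_group_residually_finite separates_if_semidirect_product_residually_finite
      semidirect_product_residually_finite_if_separates by blast
qed

end
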